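(* Let $M$ be an Orlicz function, let $m,n\ge0$ be integers and let $1\le p<\infty$. For sequences $X=(X_k)$, $Y=(Y_k)$ of fuzzy real numbers: (i) The space $C_p^F(M,\Delta_m^n)$ is a complete metric space with the metric $$f_1(X,Y)=\sum_{r=1}^{mn}\overline d(X_r,Y_r)+\inf\left\{\rho>0:\left(\sum_{i=1}^\infty\frac1i\sum_{k=1}^i\left(M\left(\frac{\overline d(\Delta_m^nX_k,\Delta_m^nY_k)}{\rho}\right)\right)^p\right)^{1/p}\le1\right\}.$$ (ii) The space $C_\infty^F(M,\Delta_m^n)$ is a complete metric space with respect to the metric $$f_2(X,Y)=\sum_{r=1}^{mn}\overline d(X_r,Y_r)+\inf\left\{\rho>0:\sup_i\frac1i\sum_{k=1}^iM\left(\frac{\overline d(\Delta_m^nX_k,\Delta_m^nY_k)}{\rho}\right)\le1\right\}.$$ (iii) The space $\ell_p^F(M,\Delta_m^n)$ is a complete metric space with respect to the metric $$f_3(X,Y)=\sum_{r=1}^{mn}\overline d(X_r,Y_r)+\inf\left\{\rho>0:\left(\sum_{k=1}^\infty\left(M\left(\frac{\overline d(\Delta_m^nX_k,\Delta_m^nY_k)}{\rho}\right)\right)^p\right)^{1/p}\le1\right\}.$$ (iv) The space $O_p^F(M,\Delta_m^n)$ is a complete metric space with the metric $$f_4(X,Y)=\sum_{r=1}^{mn}\overline d(X_r,Y_r)+\inf\left\{\rho>0:\left(\sum_{i=1}^\infty\frac1i\sum_{k=1}^i\left(M\left(\frac{\overline d(\Delta_m^nX_k,\Delta_m^nY_k)}{\rho}\right)\right)^p\right)^{1/p}\le1\right\}.$$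 (v) The space $O_\infty^F(M,\Delta_m^n)$ is a complete metric space with respect to the metric $$f_5(X,Y)=\sum_{r=1}^{mn}\overline d(X_r,Y_r)+\inf\left\{\rho>0:\sup_i\frac1i\sum_{k=1}^iM\left(\frac{\overline d(\Delta_m^nX_k,\Delta_m^nY_k)}{\rho}\right)\le1\right\}.$$
   Context: $N=\{1,2,3,\dots\}$. An Orlicz function is a continuous, non-decreasing, convex function $M:[0,\infty)\to[0,\infty)$ with $M(0)=0$, $M(x)>0$ for $x>0$, and $M(x)\to\infty$ as $x\to\infty$. A fuzzy real number is a map $X:\mathbb R\to[0,1]$. It is convex if $X(t)\ge\min(X(s),X(r))$ whenever $s<t<r$, normal if $X(t_0)=1$ for some $t_0$, and upper semi-continuous if $X^{-1}([0,a+\varepsilon))$ is open for every $\varepsilon>0$ and $a\in[0,1]$. For $0<\alpha\le1$, $X^\alpha=\{t: X(t)\ge\alpha\}$, and $X^0$ is the closure of $\{t:X(t)>0\}$. $R(I)$ denotes the set of upper semi-continuous, normal, convex fuzzy real numbers, with all level sets $X^\alpha$ ($0\le\alpha\le1$) closed bounded intervals. For closed bounded intervals $A=[A^L,A^R]$, $B=[B^L,B^R]$ put $d(A,B)=\max\{|A^L-B^L|,|A^R-B^R|\}$, and for $X,Y\in R(I)$ put $\overline d(X,Y)=\sup_{0<\alpha\le1}d(X^\alpha,Y^\alpha)$. For $r\in\mathbb R$, $\overline r\in R(I)$ is defined by $\overline r(t)=1$ if $t=r$ and $0$ otherwise. Subtraction in $R(I)$ is the usual levelwise interval subtraction: if $X^\alpha=[a,b]$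 and $Y^\alpha=[c,e]$ then $(X-Y)^\alpha=[a-e,b-c]$. For a sequence $(X_k)_{k\in N}$ in $R(I)$ and $m,n\ge1$: $\Delta_m^0X_k=X_k$ and $\Delta_m^nX_k=\Delta_m^{n-1}X_k-\Delta_m^{n-1}X_{k+m}$; if $m=0$ or $n=0$, $\Delta_m^nX_k=X_k$. The spaces consist of sequences $(X_k)$ in $R(I)$ satisfying, for some $\rho>0$, with $t_k=M\left(\overline d(\Delta_m^nX_k,\overline0)/\rho\right)$: - $C_p^F(M,\Delta_m^n)$: $\sum_{i=1}^\infty\left(\frac1i\sum_{k=1}^i t_k\right)^p<\infty$; - $C_\infty^F(M,\Delta_m^n)$: $\sup_i\frac1i\sum_{k=1}^i t_k<\infty$; - $\ell_p^F(M,\Delta_m^n)$: $\sum_{k=1}^\infty t_k^p<\infty$; - $O_p^F(M,\Delta_m^n)$: $\sum_{i=1}^\infty\frac1i\left(\sum_{k=1}^i t_k\right)^p<\infty$; - $O_\infty^F(M,\Delta_m^n)$: $\sup_i\frac1i\sum_{k=1}^i t_k<\infty$.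
   Formalization: In (i), for p>1 the printed f_1 is infinite whenever the difference sequences differ; it is shown only to be a complete [0,∞]-valued metric, and the finite complete metric is proved for the formula with the power p on the averages, as in the definition of C_p (same as f_1 for p=1). *)

theory Defs
  imports "HOL-Analysis.Analysis"
begin

section \<open>Fuzzy real numbers\<close>

definition level :: "(real \<Rightarrow> real) \<Rightarrow> real \<Rightarrow> real set" where
  "level X \<alpha> = (if \<alpha> = 0 then closure {t. X t > 0} else {t. X t \<ge> \<alpha>})"

definition fuzzy_convex :: "(real \<Rightarrow> real) \<Rightarrow> bool" where
  "fuzzy_convex X \<longleftrightarrow> (\<forall>s t r. s < t \<and> t < r \<longrightarrow> X t \<ge> min (X s) (X r))"

definition fuzzy_normal :: "(real \<Rightarrow> real) \<Rightarrow> bool" where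
  "fuzzy_normal X \<longleftrightarrow> (\<exists>t. X t = 1)"

definition fuzzy_usc :: "(real \<Rightarrow> real) \<Rightarrow> bool" where
  "fuzzy_usc X \<longleftrightarrow> (\<forall>\<epsilon>>0. \<forall>a\<in>{0..1}. open (X -` {0..<a + \<epsilon>}))"

definition RI :: "(real \<Rightarrow> real) set" where
  "RI = {X. range X \<subseteq> {0..1} \<and> fuzzy_convex X \<and> fuzzy_normal X \<and> fuzzy_usc X
          \<and> (\<forall>\<alpha>\<in>{0..1}. \<exists>a b. a \<le> b \<and> level X \<alpha> = {a..b})}"

lemma RI_I:
  assumes ran: "\<And>t. X t \<in> {0..1}"
    and lev: "\<And>\<alpha>. \<alpha> \<in> {0..1} \<Longrightarrow> \<exists>a b. a \<le> b \<and> level X \<alpha> = {a..b}"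
  shows "X \<in> RI"
proof -
  have pos: "\<exists>a b. a \<le> b \<and> {t. X t \<ge> \<alpha>} = {a..b}" if "0 < \<alpha>" "\<alpha> \<le> 1" for \<alpha>
    using lev[of \<alpha>] that by (simp add: level_def)
  have "fuzzy_convex X"
    unfolding fuzzy_convex_def
  proof (intro allI impI)
    fix s t r :: real assume str: "s < t \<and> t < r"
    define \<alpha> where "\<alpha> = min (X s) (X r)"
    show "X t \<ge> min (X s) (X r)"
    proof (cases "\<alpha> > 0")
      case True
      have "\<alpha> \<le> 1" using ran[of s] by (auto simp: \<alpha>_def)
      with True obtain a b where ab: "{t. X t \<ge> \<alpha>} = {a..b}" using pos by blast
      have "s \<in> {a..b}" "r \<in> {a..b}" unfolding ab[symmetric] by (auto simp: \<alpha>_def)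
      then have "t \<in> {a..b}" using str by auto
      then show ?thesis unfolding ab[symmetric] by (simp add: \<alpha>_def)
    next
      case False
      then show ?thesis using ran[of t] by (auto simp: \<alpha>_def)
    qed
  qed
  moreover have "fuzzy_normal X"
  proof -
    obtain a b where ab: "a \<le> b" "{t. X t \<ge> 1} = {a..b}" using pos[of 1] by auto
    then have "a \<in> {t. X t \<ge> 1}" by auto
    then show ?thesis using ran[of a] by (auto simp: fuzzy_normal_def intro!: exI[of _ a])
  qed
  moreover have "fuzzy_usc X"
    unfolding fuzzy_usc_def
  proof (intro allI impI ballI)
    fix \<epsilon> a :: real assume e: "\<epsilon> > 0" "a \<in> {0..1}"
    have eq: "X -` {0..<a + \<epsilon>} = - {t. X t \<ge> a + \<epsilon>}" using ran by auto
    have "closed {t. X t \<ge> a + \<epsilon>}"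
    proof (cases "a + \<epsilon> \<le> 1")
      case True
      then show ?thesis using pos[of "a + \<epsilon>"] e by auto
    next
      case False
      have "\<not> a + \<epsilon> \<le> X t" for t using False ran[of t] by simp
      then have "{t. X t \<ge> a + \<epsilon>} = {}" by simp
      then show ?thesis by simp
    qed
    then show "open (X -` {0..<a + \<epsilon>})" by (simp add: eq open_closed)
  qed
  ultimately show ?thesis using ran lev by (auto simp: RI_def)
qed

lemma indicator_in_RI: "(\<lambda>t. if t = r then 1 else 0) \<in> RI"
proof (rule RI_I)
  fix \<alpha> :: real assume "\<alpha> \<in> {0..1}"
  then have "level (\<lambda>t. if t = r then 1 else 0) \<alpha> = {r..r}"
    by (auto simp: level_def)
  then show "\<exists>a b. a \<le> b \<and> level (\<lambda>t. if t = r then 1 else 0) \<alpha> = {a..b}" by blast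
qed auto

typedef fuzzy_real = RI
  using indicator_in_RI by blast

setup_lifting type_definition_fuzzy_real

lift_definition crisp :: "real \<Rightarrow> fuzzy_real" is "\<lambda>r t. if t = r then 1 else 0"
  by (rule indicator_in_RI)

definition lev :: "fuzzy_real \<Rightarrow> real \<Rightarrow> real set" where
  "lev X \<alpha> = level (Rep_fuzzy_real X) \<alpha>"

text \<open>Left and right endpoints of the level intervals.\<close>

definition lo :: "fuzzy_real \<Rightarrow> real \<Rightarrow> real" where "lo X \<alpha> = Inf (lev X \<alpha>)"
definition hi :: "fuzzy_real \<Rightarrow> real \<Rightarrow> real" where "hi X \<alpha> = Sup (lev X \<alpha>)"

lemma lev_eq:
  assumes "\<alpha> \<in> {0..1}"
  shows "lev X \<alpha> = {lo X \<alpha>..hi X \<alpha>}" and "lo X \<alpha> \<le> hi X \<alpha>"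
proof -
  obtain a b where "a \<le> b" "lev X \<alpha> = {a..b}"
    using Rep_fuzzy_real[of X] assms unfolding RI_def lev_def by blast
  then show "lev X \<alpha> = {lo X \<alpha>..hi X \<alpha>}" "lo X \<alpha> \<le> hi X \<alpha>"
    by (simp_all add: lo_def hi_def)
qed

lemma fuzzy_real_range: "0 \<le> Rep_fuzzy_real X t" "Rep_fuzzy_real X t \<le> 1"
proof -
  have "range (Rep_fuzzy_real X) \<subseteq> {0..1}" using Rep_fuzzy_real[of X] by (simp add: RI_def)
  then have "Rep_fuzzy_real X t \<in> {0..1}" by blast
  then show "0 \<le> Rep_fuzzy_real X t" "Rep_fuzzy_real X t \<le> 1" by auto
qed

lemma lev_pos: "\<alpha> > 0 \<Longrightarrow> lev X \<alpha> = {t. Rep_fuzzy_real X t \<ge> \<alpha>}"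
  by (simp add: lev_def level_def)

lemma fuzzy_real_eqI:
  assumes "\<And>\<alpha>. 0 < \<alpha> \<Longrightarrow> \<alpha> \<le> 1 \<Longrightarrow> lev X \<alpha> = lev Y \<alpha>"
  shows "X = Y"
proof -
  have "Rep_fuzzy_real X t \<le> Rep_fuzzy_real Y t"
    if eq: "\<And>\<alpha>. 0 < \<alpha> \<Longrightarrow> \<alpha> \<le> 1 \<Longrightarrow> lev X \<alpha> = lev Y \<alpha>" for X Y t
  proof (cases "Rep_fuzzy_real X t > 0")
    case True
    let ?a = "Rep_fuzzy_real X t"
    have "t \<in> lev X ?a" using True by (simp add: lev_pos)
    then have "t \<in> lev Y ?a" using eq[OF True fuzzy_real_range(2)] by simp
    then show ?thesis using True by (simp add: lev_pos)
  next
    case False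
    then show ?thesis using fuzzy_real_range(1)[of Y t] by linarith
  qed
  from this[of X Y] this[of Y X] assms
  have "Rep_fuzzy_real X = Rep_fuzzy_real Y" by (intro ext antisym) auto
  then show ?thesis by (simp add: Rep_fuzzy_real_inject)
qed

lemma levelwise_diff_exists:
  "\<exists>Z. \<forall>\<alpha>\<in>{0..1}. lev Z \<alpha> = {lo X \<alpha> - hi Y \<alpha>..hi X \<alpha> - lo Y \<alpha>}"
proof -
  let ?X = "Rep_fuzzy_real X" and ?Y = "Rep_fuzzy_real Y"
  define S where "S \<beta> t = {s. \<beta> \<le> ?X s \<and> \<beta> \<le> ?Y (s - t)}" for \<beta> t
  define A where "A t = {\<beta>\<in>{0..1}. \<beta> = 0 \<or> S \<beta> t \<noteq> {}}" for t
  define Z where "Z t = Sup (A t)" for t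
  have A0: "0 \<in> A t" for t by (simp add: A_def)
  have Abdd: "bdd_above (A t)" for t by (auto simp: A_def intro!: bdd_aboveI[of _ 1])
  have Zran: "Z t \<in> {0..1}" for t
  proof -
    have "0 \<le> Z t" unfolding Z_def by (rule cSup_upper[OF A0 Abdd])
    moreover have "A t \<noteq> {}" using A0 by blast
    then have "Z t \<le> 1" unfolding Z_def by (rule cSup_least) (simp add: A_def)
    ultimately show ?thesis by simp
  qed
  have S_eq: "S \<beta> t = {lo X \<beta>..hi X \<beta>} \<inter> {lo Y \<beta> + t..hi Y \<beta> + t}"
    if "0 < \<beta>" "\<beta> \<le> 1" for \<beta> t
  proof -
    have "S \<beta> t = {s. s \<in> lev X \<beta> \<and> s - t \<in> lev Y \<beta>}"
      using that by (auto simp: S_def lev_pos)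
    moreover have "lev X \<beta> = {lo X \<beta>..hi X \<beta>}" "lev Y \<beta> = {lo Y \<beta>..hi Y \<beta>}"
      using that by (auto intro!: lev_eq)
    ultimately show ?thesis by auto
  qed
  have S_ne: "S \<beta> t \<noteq> {} \<longleftrightarrow> t \<in> {lo X \<beta> - hi Y \<beta>..hi X \<beta> - lo Y \<beta>}"
    if "0 < \<beta>" "\<beta> \<le> 1" for \<beta> t
    unfolding S_eq[OF that] using that lev_eq(2)[of \<beta> X] lev_eq(2)[of \<beta> Y] by (auto simp: Int_atLeastAtMost)
  have Z_ge: "\<alpha> \<le> Z t \<longleftrightarrow> S \<alpha> t \<noteq> {}" if \<alpha>: "0 < \<alpha>" "\<alpha> \<le> 1" for \<alpha> t
  proof
    assume "S \<alpha> t \<noteq> {}"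
    then have "\<alpha> \<in> A t" using \<alpha> by (simp add: A_def)
    then show "\<alpha> \<le> Z t" unfolding Z_def by (rule cSup_upper[OF _ Abdd])
  next
    assume le: "\<alpha> \<le> Z t"
    define \<beta> where "\<beta> n = \<alpha> - \<alpha> / real (n + 2)" for n :: nat
    have b: "0 < \<beta> n" "\<beta> n < \<alpha>" for n
      using \<alpha> by (auto simp: \<beta>_def field_simps intro: add_pos_nonneg)
    have "\<Inter> (range (\<lambda>n. S (\<beta> n) t)) \<noteq> {}"
    proof (rule compact_nest)
      fix n :: nat
      have "\<beta> n \<le> 1" using b[of n] \<alpha> by linarith
      then show "compact (S (\<beta> n) t)" using b by (subst S_eq) auto
      have "\<beta> n < Sup (A t)" using b[of n] le by (simp add: Z_def)
      then obtain \<gamma> where "\<gamma> \<in> A t" "\<beta> n < \<gamma>"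
        using A0 less_cSup_iff[OF _ Abdd] by blast
      moreover from this obtain s where "s \<in> S \<gamma> t" using b(1)[of n] by (auto simp: A_def)
      ultimately have "s \<in> S (\<beta> n) t" by (simp add: S_def)
      then show "S (\<beta> n) t \<noteq> {}" by blast
    next
      fix i j :: nat assume "i \<le> j"
      then have "\<beta> i \<le> \<beta> j" using \<alpha> by (auto simp: \<beta>_def intro!: divide_left_mono)
      then show "S (\<beta> j) t \<subseteq> S (\<beta> i) t" by (auto simp: S_def)
    qed
    then obtain s where s: "\<And>n. s \<in> S (\<beta> n) t" by auto
    have "(\<lambda>n. \<alpha> / real (n + 2)) \<longlonglongrightarrow> 0"
      using LIMSEQ_ignore_initial_segment[OF lim_const_over_n[of \<alpha>], of 2] by simp
    then have lim: "\<beta> \<longlonglongrightarrow> \<alpha>"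
      unfolding \<beta>_def using tendsto_diff[OF tendsto_const[of \<alpha>]] by fastforce
    have "\<alpha> \<le> ?X s" "\<alpha> \<le> ?Y (s - t)"
      using s by (auto intro!: LIMSEQ_le_const2[OF lim] simp: S_def)
    then show "S \<alpha> t \<noteq> {}" by (auto simp: S_def)
  qed
  have lev1: "level Z \<alpha> = {lo X \<alpha> - hi Y \<alpha>..hi X \<alpha> - lo Y \<alpha>}" if "0 < \<alpha>" "\<alpha> \<le> 1" for \<alpha>
    using that Z_ge[OF that] S_ne[OF that] by (auto simp: level_def)
  have pos: "Z t > 0 \<longleftrightarrow> (\<exists>s. ?X s > 0 \<and> ?Y (s - t) > 0)" for t
  proof
    assume "Z t > 0"
    then have "S (Z t) t \<noteq> {}" using Z_ge[of "Z t" t] Zran[of t] by auto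
    then obtain s where "Z t \<le> ?X s" "Z t \<le> ?Y (s - t)" by (auto simp: S_def)
    then have "?X s > 0 \<and> ?Y (s - t) > 0" using \<open>Z t > 0\<close> by linarith
    then show "\<exists>s. ?X s > 0 \<and> ?Y (s - t) > 0" by blast
  next
    assume "\<exists>s. ?X s > 0 \<and> ?Y (s - t) > 0"
    then obtain s where s: "?X s > 0" "?Y (s - t) > 0" by blast
    define \<beta> where "\<beta> = min (?X s) (?Y (s - t))"
    have "0 < \<beta>" "\<beta> \<le> 1" using s fuzzy_real_range(2)[of X s] by (auto simp: \<beta>_def)
    moreover have "s \<in> S \<beta> t" by (simp add: S_def \<beta>_def)
    ultimately have "\<beta> \<le> Z t" using Z_ge by blast
    then show "Z t > 0" using \<open>0 < \<beta>\<close> by linarith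
  qed
  have cl: "closure {t. Rep_fuzzy_real V t > 0} = {lo V 0..hi V 0}" for V
    using lev_eq(1)[of 0 V] by (simp add: lev_def level_def)
  have lev0: "level Z 0 = {lo X 0 - hi Y 0..hi X 0 - lo Y 0}"
  proof (rule antisym)
    have "t \<in> {lo X 0 - hi Y 0..hi X 0 - lo Y 0}" if "Z t > 0" for t
    proof -
      from \<open>Z t > 0\<close> obtain s where s: "?X s > 0" "?Y (s - t) > 0"
        unfolding pos by blast
      have "s \<in> closure {t. ?X t > 0}" "s - t \<in> closure {t. ?Y t > 0}"
        by (rule subsetD[OF closure_subset], simp add: s)+
      then show ?thesis unfolding cl by simp
    qed
    then have "{t. Z t > 0} \<subseteq> {lo X 0 - hi Y 0..hi X 0 - lo Y 0}" by blast
    then have "closure {t. Z t > 0} \<subseteq> {lo X 0 - hi Y 0..hi X 0 - lo Y 0}"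
      by (rule closure_minimal) simp
    then show "level Z 0 \<subseteq> {lo X 0 - hi Y 0..hi X 0 - lo Y 0}" by (simp add: level_def)
  next
    show "{lo X 0 - hi Y 0..hi X 0 - lo Y 0} \<subseteq> level Z 0"
    proof
      fix t assume t: "t \<in> {lo X 0 - hi Y 0..hi X 0 - lo Y 0}"
      define x where "x = max (lo X 0) (lo Y 0 + t)"
      have x: "x \<in> {lo X 0..hi X 0}" "x - t \<in> {lo Y 0..hi Y 0}"
        using t lev_eq(2)[of 0 X] lev_eq(2)[of 0 Y] by (auto simp: x_def)
      from x obtain p q where p: "\<And>n. ?X (p n) > 0" "p \<longlonglongrightarrow> x"
        and q: "\<And>n. ?Y (q n) > 0" "q \<longlonglongrightarrow> x - t"
        unfolding cl[symmetric] closure_sequential by auto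
      have "Z (p n - q n) > 0" for n
        unfolding pos using p(1)[of n] q(1)[of n] by (intro exI[of _ "p n"]) simp
      moreover have "(\<lambda>n. p n - q n) \<longlonglongrightarrow> t" using tendsto_diff[OF p(2) q(2)] by simp
      ultimately have "t \<in> closure {t. Z t > 0}"
        unfolding closure_sequential by (intro exI[of _ "\<lambda>n. p n - q n"]) simp
      then show "t \<in> level Z 0" by (simp add: level_def)
    qed
  qed
  have levs: "level Z \<alpha> = {lo X \<alpha> - hi Y \<alpha>..hi X \<alpha> - lo Y \<alpha>}" if "\<alpha> \<in> {0..1}" for \<alpha>
    using lev0 lev1[of \<alpha>] that by (cases "\<alpha> = 0") auto
  have "Z \<in> RI"
  proof (rule RI_I[OF Zran])
    fix \<alpha> :: real assume "\<alpha> \<in> {0..1}"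
    then show "\<exists>a b. a \<le> b \<and> level Z \<alpha> = {a..b}"
      using levs[of \<alpha>] lev_eq(2)[of \<alpha> X] lev_eq(2)[of \<alpha> Y] by force
  qed
  then show ?thesis
    using levs by (intro exI[of _ "Abs_fuzzy_real Z"]) (simp add: lev_def Abs_fuzzy_real_inverse)
qed

instantiation fuzzy_real :: minus
begin

definition minus_fuzzy_real :: "fuzzy_real \<Rightarrow> fuzzy_real \<Rightarrow> fuzzy_real" where
  "X - Y = (THE Z. \<forall>\<alpha>\<in>{0..1}. lev Z \<alpha> = {lo X \<alpha> - hi Y \<alpha>..hi X \<alpha> - lo Y \<alpha>})"

instance ..

end

lemma lev_diff:
  assumes "\<alpha> \<in> {0..1}"
  shows "lev (X - Y) \<alpha> = {lo X \<alpha> - hi Y \<alpha>..hi X \<alpha> - lo Y \<alpha>}"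
proof -
  have "\<exists>!Z. \<forall>\<alpha>\<in>{0..1}. lev Z \<alpha> = {lo X \<alpha> - hi Y \<alpha>..hi X \<alpha> - lo Y \<alpha>}"
    using levelwise_diff_exists by (rule ex_ex1I) (simp add: fuzzy_real_eqI)
  from theI'[OF this] show ?thesis using assms by (simp add: minus_fuzzy_real_def)
qed

definition dbar :: "fuzzy_real \<Rightarrow> fuzzy_real \<Rightarrow> real" where
  "dbar X Y = (SUP \<alpha>\<in>{0<..1}. max \<bar>lo X \<alpha> - lo Y \<alpha>\<bar> \<bar>hi X \<alpha> - hi Y \<alpha>\<bar>)"

lemma dbar_bdd: "bdd_above ((\<lambda>\<alpha>. max \<bar>lo X \<alpha> - lo Y \<alpha>\<bar> \<bar>hi X \<alpha> - hi Y \<alpha>\<bar>) ` {0<..1})"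
proof -
  have sub: "lo V 0 \<le> lo V \<alpha> \<and> lo V \<alpha> \<le> hi V \<alpha> \<and> hi V \<alpha> \<le> hi V 0" if "\<alpha> \<in> {0<..1}" for V \<alpha>
  proof -
    have "lev V \<alpha> \<subseteq> lev V 0"
      using that closure_subset[of "{t. Rep_fuzzy_real V t > 0}"] by (auto simp: lev_def level_def)
    then show ?thesis using that lev_eq[of \<alpha> V] lev_eq[of 0 V] by auto
  qed
  show ?thesis
  proof (rule bdd_aboveI2)
    fix \<alpha> :: real assume a: "\<alpha> \<in> {0<..1}"
    show "max \<bar>lo X \<alpha> - lo Y \<alpha>\<bar> \<bar>hi X \<alpha> - hi Y \<alpha>\<bar> \<le> \<bar>hi X 0 - lo Y 0\<bar> + \<bar>hi Y 0 - lo X 0\<bar>"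
      using sub[OF a, of X] sub[OF a, of Y] by linarith
  qed
qed

section \<open>Orlicz functions and difference sequences\<close>

definition orlicz :: "(real \<Rightarrow> real) \<Rightarrow> bool" where
  "orlicz M \<longleftrightarrow> continuous_on {0..} M \<and> mono_on {0..} M \<and> convex_on {0..} M
     \<and> M 0 = 0 \<and> (\<forall>x>0. M x > 0) \<and> filterlim M at_top at_top"

text \<open>
  Sequences are indexed from 0: the value at k is the (k+1)-st term of a
  sequence indexed by 1, 2, 3, ... Accordingly r = 1, ..., mn becomes r < m * n, the averages
  are taken over k \<le> i and divided by Suc i, and the sums over i = 1, 2, ...
  become sums over all natural numbers i.
\<close>

primrec fdiff :: "nat \<Rightarrow> nat \<Rightarrow> (nat \<Rightarrow> fuzzy_real) \<Rightarrow> nat \<Rightarrow> fuzzy_real" where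
  "fdiff m 0 X = X"
| "fdiff m (Suc n) X = (if m = 0 then X else (\<lambda>k. fdiff m n X k - fdiff m n X (k + m)))"

section \<open>The sequence spaces\<close>

definition tseq :: "(real \<Rightarrow> real) \<Rightarrow> nat \<Rightarrow> nat \<Rightarrow> real \<Rightarrow> (nat \<Rightarrow> fuzzy_real) \<Rightarrow> nat \<Rightarrow> real" where
  "tseq M m n \<rho> X k = M (dbar (fdiff m n X k) (crisp 0) / \<rho>)"

definition C_p :: "real \<Rightarrow> (real \<Rightarrow> real) \<Rightarrow> nat \<Rightarrow> nat \<Rightarrow> (nat \<Rightarrow> fuzzy_real) set" where
  "C_p p M m n = {X. \<exists>\<rho>>0.
     summable (\<lambda>i. ((1 / real (Suc i)) * (\<Sum>k\<le>i. tseq M m n \<rho> X k)) powr p)}"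

definition C_inf :: "(real \<Rightarrow> real) \<Rightarrow> nat \<Rightarrow> nat \<Rightarrow> (nat \<Rightarrow> fuzzy_real) set" where
  "C_inf M m n = {X. \<exists>\<rho>>0.
     bdd_above (range (\<lambda>i. (1 / real (Suc i)) * (\<Sum>k\<le>i. tseq M m n \<rho> X k)))}"

definition l_p :: "real \<Rightarrow> (real \<Rightarrow> real) \<Rightarrow> nat \<Rightarrow> nat \<Rightarrow> (nat \<Rightarrow> fuzzy_real) set" where
  "l_p p M m n = {X. \<exists>\<rho>>0. summable (\<lambda>k. tseq M m n \<rho> X k powr p)}"

definition O_p :: "real \<Rightarrow> (real \<Rightarrow> real) \<Rightarrow> nat \<Rightarrow> nat \<Rightarrow> (nat \<Rightarrow> fuzzy_real) set" where
  "O_p p M m n = {X. \<exists>\<rho>>0.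
     summable (\<lambda>i. (1 / real (Suc i)) * (\<Sum>k\<le>i. tseq M m n \<rho> X k) powr p)}"

definition O_inf :: "(real \<Rightarrow> real) \<Rightarrow> nat \<Rightarrow> nat \<Rightarrow> (nat \<Rightarrow> fuzzy_real) set" where
  "O_inf M m n = {X. \<exists>\<rho>>0.
     bdd_above (range (\<lambda>i. (1 / real (Suc i)) * (\<Sum>k\<le>i. tseq M m n \<rho> X k)))}"

section \<open>The distance functions\<close>

definition dseq :: "(real \<Rightarrow> real) \<Rightarrow> nat \<Rightarrow> nat \<Rightarrow> real
    \<Rightarrow> (nat \<Rightarrow> fuzzy_real) \<Rightarrow> (nat \<Rightarrow> fuzzy_real) \<Rightarrow> nat \<Rightarrow> real" where
  "dseq M m n \<rho> X Y k = M (dbar (fdiff m n X k) (fdiff m n Y k) / \<rho>)"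

text \<open>For a nonnegative sequence a: the extended real (sum of a)^(1/p) is at most 1.
  A divergent sum counts as infinite.\<close>

definition root_sum_le_1 :: "real \<Rightarrow> (nat \<Rightarrow> real) \<Rightarrow> bool" where
  "root_sum_le_1 p a \<longleftrightarrow> summable a \<and> (\<Sum>i. a i) powr (1 / p) \<le> 1"

definition sup_le_1 :: "(nat \<Rightarrow> real) \<Rightarrow> bool" where
  "sup_le_1 a \<longleftrightarrow> bdd_above (range a) \<and> (SUP i. a i) \<le> 1"

text \<open>The common shape of the distances. The infimum is taken in the extended half-line, so it
  is infinite when no \<rho> is admissible.\<close>

definition dist_shape :: "nat \<Rightarrow> nat \<Rightarrow> (nat \<Rightarrow> fuzzy_real) \<Rightarrow> (nat \<Rightarrow> fuzzy_real)
    \<Rightarrow> (real \<Rightarrow> bool) \<Rightarrow> ennreal" where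
  "dist_shape m n X Y P =
     ennreal (\<Sum>r<m * n. dbar (X r) (Y r)) + (INF \<rho>\<in>{\<rho>. \<rho> > 0 \<and> P \<rho>}. ennreal \<rho>)"

definition f1 :: "real \<Rightarrow> (real \<Rightarrow> real) \<Rightarrow> nat \<Rightarrow> nat \<Rightarrow> (nat \<Rightarrow> fuzzy_real)
    \<Rightarrow> (nat \<Rightarrow> fuzzy_real) \<Rightarrow> ennreal" where
  "f1 p M m n X Y = dist_shape m n X Y (\<lambda>\<rho>.
     root_sum_le_1 p (\<lambda>i. (1 / real (Suc i)) * (\<Sum>k\<le>i. dseq M m n \<rho> X Y k powr p)))"

text \<open>The variant of f1 that matches the definition of C_p, with the power p applied
  to the averages.  For p > 1, f1 is infinite as soon as the two difference sequences differ,
  by divergence of the harmonic series.\<close>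

definition f1_avg :: "real \<Rightarrow> (real \<Rightarrow> real) \<Rightarrow> nat \<Rightarrow> nat \<Rightarrow> (nat \<Rightarrow> fuzzy_real)
    \<Rightarrow> (nat \<Rightarrow> fuzzy_real) \<Rightarrow> ennreal" where
  "f1_avg p M m n X Y = dist_shape m n X Y (\<lambda>\<rho>.
     root_sum_le_1 p (\<lambda>i. ((1 / real (Suc i)) * (\<Sum>k\<le>i. dseq M m n \<rho> X Y k)) powr p))"

definition f2 :: "(real \<Rightarrow> real) \<Rightarrow> nat \<Rightarrow> nat \<Rightarrow> (nat \<Rightarrow> fuzzy_real)
    \<Rightarrow> (nat \<Rightarrow> fuzzy_real) \<Rightarrow> ennreal" where
  "f2 M m n X Y = dist_shape m n X Y (\<lambda>\<rho>.
     sup_le_1 (\<lambda>i. (1 / real (Suc i)) * (\<Sum>k\<le>i. dseq M m n \<rho> X Y k)))"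

definition f3 :: "real \<Rightarrow> (real \<Rightarrow> real) \<Rightarrow> nat \<Rightarrow> nat \<Rightarrow> (nat \<Rightarrow> fuzzy_real)
    \<Rightarrow> (nat \<Rightarrow> fuzzy_real) \<Rightarrow> ennreal" where
  "f3 p M m n X Y = dist_shape m n X Y (\<lambda>\<rho>.
     root_sum_le_1 p (\<lambda>k. dseq M m n \<rho> X Y k powr p))"

definition f4 :: "real \<Rightarrow> (real \<Rightarrow> real) \<Rightarrow> nat \<Rightarrow> nat \<Rightarrow> (nat \<Rightarrow> fuzzy_real)
    \<Rightarrow> (nat \<Rightarrow> fuzzy_real) \<Rightarrow> ennreal" where
  "f4 p M m n X Y = dist_shape m n X Y (\<lambda>\<rho>.
     root_sum_le_1 p (\<lambda>i. (1 / real (Suc i)) * (\<Sum>k\<le>i. dseq M m n \<rho> X Y k powr p)))"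

definition f5 :: "(real \<Rightarrow> real) \<Rightarrow> nat \<Rightarrow> nat \<Rightarrow> (nat \<Rightarrow> fuzzy_real)
    \<Rightarrow> (nat \<Rightarrow> fuzzy_real) \<Rightarrow> ennreal" where
  "f5 M m n X Y = dist_shape m n X Y (\<lambda>\<rho>.
     sup_le_1 (\<lambda>i. (1 / real (Suc i)) * (\<Sum>k\<le>i. dseq M m n \<rho> X Y k)))"

section \<open>Complete metric spaces\<close>

text \<open>A genuine (finite-valued) metric on S, complete in the sense of the library. Finiteness is
  required separately because enn2real sends infinity to 0.\<close>

definition complete_metric_on :: "'a set \<Rightarrow> ('a \<Rightarrow> 'a \<Rightarrow> ennreal) \<Rightarrow> bool" where
  "complete_metric_on S f \<longleftrightarrow>
     (\<forall>x\<in>S. \<forall>y\<in>S. f x y < \<infinity>)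
     \<and> Metric_space S (\<lambda>x y. enn2real (f x y))
     \<and> Metric_space.mcomplete S (\<lambda>x y. enn2real (f x y))"

text \<open>The same axioms for a distance that may take the value infinity.\<close>

definition complete_extended_metric_on :: "'a set \<Rightarrow> ('a \<Rightarrow> 'a \<Rightarrow> ennreal) \<Rightarrow> bool" where
  "complete_extended_metric_on S f \<longleftrightarrow>
     (\<forall>x\<in>S. \<forall>y\<in>S. f x y = 0 \<longleftrightarrow> x = y)
     \<and> (\<forall>x\<in>S. \<forall>y\<in>S. f x y = f y x)
     \<and> (\<forall>x\<in>S. \<forall>y\<in>S. \<forall>z\<in>S. f x z \<le> f x y + f y z)
     \<and> (\<forall>\<sigma>. range \<sigma> \<subseteq> S \<and> (\<forall>\<epsilon>>0. \<exists>N. \<forall>i\<ge>N. \<forall>j\<ge>N. f (\<sigma> i) (\<sigma> j) < \<epsilon>)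
          \<longrightarrow> (\<exists>x\<in>S. (\<lambda>i. f (\<sigma> i) x) \<longlonglongrightarrow> 0))"

end

theory Submission
  imports Defs
begin

text \<open>
  Under the metric dbar the fuzzy real numbers are complete, and subtraction is 1-Lipschitz and
  cancellative; hence X is determined, with control of Cauchy sequences, by its first
  mn terms and its difference sequence. Each infimum is a Luxemburg gauge: its admissibility
  condition says that countably many functionals F N, convex, monotone and continuous for
  coordinatewise convergence of nonnegative sequences, are at most 1 at M(d/\<rho>). Convexity gives the
  triangle inequality, continuity lets admissibility pass to limits, and this makes the gauge
  distance complete. Finiteness of the gauge against the zero sequence describes the space itself.
  The weights 1/i in f1, f4 and O_p make the harmonic series appear: there only the zero difference
  sequence has a finite gauge, so O_p consists of the sequences with zero differences and f1 is
  infinite between sequences with distinct differences.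
\<close>

section \<open>Completeness of the fuzzy real numbers\<close>

lemma lev_mono:
  assumes "0 < \<alpha>" "\<alpha> \<le> \<beta>" "\<beta> \<le> 1"
  shows "lo X \<alpha> \<le> lo X \<beta>" "hi X \<beta> \<le> hi X \<alpha>"
proof -
  have "lev X \<beta> \<subseteq> lev X \<alpha>" using assms by (auto simp: lev_pos)
  then have "{lo X \<beta>..hi X \<beta>} \<subseteq> {lo X \<alpha>..hi X \<alpha>}"
    using lev_eq(1)[of \<alpha> X] lev_eq(1)[of \<beta> X] assms by auto
  then show "lo X \<alpha> \<le> lo X \<beta>" "hi X \<beta> \<le> hi X \<alpha>"
    using lev_eq(2)[of \<beta> X] assms by auto
qed

text \<open>At a positive height the level set is a superlevel set, hence the intersection of the
  level sets at smaller positive heights.\<close>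

lemma lev_left_continuous:
  assumes \<alpha>: "0 < \<alpha>" "\<alpha> \<le> 1" and t: "\<And>\<beta>. 0 < \<beta> \<Longrightarrow> \<beta> < \<alpha> \<Longrightarrow> t \<in> lev X \<beta>"
  shows "t \<in> lev X \<alpha>"
proof -
  have "\<alpha> \<le> Rep_fuzzy_real X t"
  proof (rule dense_le_bounded[of 0])
    fix \<beta> assume "0 < \<beta>" "\<beta> < \<alpha>"
    then show "\<beta> \<le> Rep_fuzzy_real X t" using t[of \<beta>] by (simp add: lev_pos)
  qed (use \<alpha> in auto)
  then show ?thesis using \<alpha> by (simp add: lev_pos)
qed

text \<open>A point \<open>t\<close> to the left of \<open>lo X \<alpha>\<close> is also to the left
  of \<open>hi X \<beta>\<close> for every lower \<beta>. With the assumed bound it lies in every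
  lower level, hence in the level at \<alpha>, which is absurd.\<close>

lemma lo_left_continuous:
  assumes \<alpha>: "0 < \<alpha>" "\<alpha> \<le> 1" and t: "\<And>\<beta>. 0 < \<beta> \<Longrightarrow> \<beta> < \<alpha> \<Longrightarrow> lo X \<beta> \<le> t"
  shows "lo X \<alpha> \<le> t"
proof (rule ccontr)
  assume less: "\<not> lo X \<alpha> \<le> t"
  have "t \<in> lev X \<alpha>"
  proof (rule lev_left_continuous[OF \<alpha>])
    fix \<beta> :: real assume b: "0 < \<beta>" "\<beta> < \<alpha>"
    have "t \<le> hi X \<beta>"
      using less lev_eq(2)[of \<alpha> X] lev_mono(2)[of \<beta> \<alpha> X] \<alpha> b by auto
    then show "t \<in> lev X \<beta>" using lev_eq(1)[of \<beta> X] t[OF b] b \<alpha> by auto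
  qed
  then show False using less lev_eq(1)[of \<alpha> X] \<alpha> by auto
qed

lemma hi_left_continuous:
  assumes \<alpha>: "0 < \<alpha>" "\<alpha> \<le> 1" and t: "\<And>\<beta>. 0 < \<beta> \<Longrightarrow> \<beta> < \<alpha> \<Longrightarrow> t \<le> hi X \<beta>"
  shows "t \<le> hi X \<alpha>"
proof (rule ccontr)
  assume less: "\<not> t \<le> hi X \<alpha>"
  have "t \<in> lev X \<alpha>"
  proof (rule lev_left_continuous[OF \<alpha>])
    fix \<beta> :: real assume b: "0 < \<beta>" "\<beta> < \<alpha>"
    have "lo X \<beta> \<le> t"
      using less lev_eq(2)[of \<alpha> X] lev_mono(1)[of \<beta> \<alpha> X] \<alpha> b by auto
    then show "t \<in> lev X \<beta>" using lev_eq(1)[of \<beta> X] t[OF b] b \<alpha> by auto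
  qed
  then show False using less lev_eq(1)[of \<alpha> X] \<alpha> by auto
qed

text \<open>A decreasing, left-continuous family of nonempty compact intervals is a family of level
  sets: the membership grade of \<open>t\<close> is the supremum of the heights whose interval
  contains \<open>t\<close>, with 0 adjoined to keep that set nonempty. The bounds \<open>B\<close>
  and \<open>C\<close> make the closure of the support compact, as level 0 requires. This is how
  limits of fuzzy numbers are constructed.\<close>

lemma fuzzy_real_of_levels:
  assumes le: "\<And>\<alpha>. 0 < \<alpha> \<Longrightarrow> \<alpha> \<le> 1 \<Longrightarrow> l \<alpha> \<le> h \<alpha>"
    and mono: "\<And>\<alpha> \<beta>. 0 < \<alpha> \<Longrightarrow> \<alpha> \<le> \<beta> \<Longrightarrow> \<beta> \<le> 1 \<Longrightarrow> l \<alpha> \<le> l \<beta> \<and> h \<beta> \<le> h \<alpha>"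
    and left: "\<And>\<alpha> t. 0 < \<alpha> \<Longrightarrow> \<alpha> \<le> 1 \<Longrightarrow> (\<And>\<beta>. 0 < \<beta> \<Longrightarrow> \<beta> < \<alpha> \<Longrightarrow> t \<in> {l \<beta>..h \<beta>}) \<Longrightarrow> t \<in> {l \<alpha>..h \<alpha>}"
    and bound: "\<And>\<alpha>. 0 < \<alpha> \<Longrightarrow> \<alpha> \<le> 1 \<Longrightarrow> B \<le> l \<alpha> \<and> h \<alpha> \<le> (C :: real)"
  shows "\<exists>Z. \<forall>\<alpha>\<in>{0<..1}. lev Z \<alpha> = {l \<alpha>..h \<alpha>}"
proof -
  define A where "A t = {\<beta>\<in>{0..1}. \<beta> = 0 \<or> t \<in> {l \<beta>..h \<beta>}}" for t
  define Z where "Z t = Sup (A t)" for t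
  have A0: "0 \<in> A t" for t by (simp add: A_def)
  have Abdd: "bdd_above (A t)" for t by (auto simp: A_def intro!: bdd_aboveI[of _ 1])
  have Zran: "Z t \<in> {0..1}" for t
  proof -
    have "0 \<le> Z t" unfolding Z_def by (rule cSup_upper[OF A0 Abdd])
    moreover have "A t \<noteq> {}" using A0 by blast
    then have "Z t \<le> 1" unfolding Z_def by (rule cSup_least) (simp add: A_def)
    ultimately show ?thesis by simp
  qed
  have Z_ge: "\<alpha> \<le> Z t \<longleftrightarrow> t \<in> {l \<alpha>..h \<alpha>}" if \<alpha>: "0 < \<alpha>" "\<alpha> \<le> 1" for \<alpha> t
  proof
    assume "t \<in> {l \<alpha>..h \<alpha>}"
    then have "\<alpha> \<in> A t" using \<alpha> by (simp add: A_def)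
    then show "\<alpha> \<le> Z t" unfolding Z_def by (rule cSup_upper[OF _ Abdd])
  next
    assume ge: "\<alpha> \<le> Z t"
    show "t \<in> {l \<alpha>..h \<alpha>}"
    proof (rule left[OF \<alpha>])
      fix \<beta> :: real assume b: "0 < \<beta>" "\<beta> < \<alpha>"
      then have "\<beta> < Sup (A t)" using ge by (simp add: Z_def)
      then obtain \<gamma> where "\<gamma> \<in> A t" "\<beta> < \<gamma>"
        using A0 less_cSup_iff[OF _ Abdd] by blast
      then show "t \<in> {l \<beta>..h \<beta>}" using mono[of \<beta> \<gamma>] b by (auto simp: A_def)
    qed
  qed
  have lev1: "level Z \<alpha> = {l \<alpha>..h \<alpha>}" if "0 < \<alpha>" "\<alpha> \<le> 1" for \<alpha>
  proof -
    have "{t. \<alpha> \<le> Z t} = {l \<alpha>..h \<alpha>}" using Z_ge[OF that] by blast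
    then show ?thesis using that by (simp add: level_def)
  qed
  have pos: "{t. Z t > 0} = (\<Union>\<alpha>\<in>{0<..1}. {l \<alpha>..h \<alpha>})"
  proof (intro set_eqI iffI)
    fix t assume "t \<in> {t. Z t > 0}"
    then show "t \<in> (\<Union>\<alpha>\<in>{0<..1}. {l \<alpha>..h \<alpha>})"
      using Z_ge[of "Z t" t] Zran[of t] by (intro UN_I[of "Z t"]) auto
  next
    fix t assume "t \<in> (\<Union>\<alpha>\<in>{0<..1}. {l \<alpha>..h \<alpha>})"
    then obtain \<alpha> where "\<alpha> \<in> {0<..1}" "t \<in> {l \<alpha>..h \<alpha>}" by (rule UN_E)
    then show "t \<in> {t. Z t > 0}" using Z_ge[of \<alpha> t] by auto
  qed
  have "Z \<in> RI"
  proof (rule RI_I[OF Zran])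
    fix \<alpha> :: real assume a: "\<alpha> \<in> {0..1}"
    show "\<exists>a b. a \<le> b \<and> level Z \<alpha> = {a..b}"
    proof (cases "\<alpha> = 0")
      case True
      let ?U = "\<Union>\<alpha>\<in>{0<..1}. {l \<alpha>..h \<alpha>}"
      \<comment> \<open>The interval at height 1 lies inside all the others, so its left end is
        common to all of them; this makes their union connected.\<close>
      have mid: "l 1 \<in> {l \<alpha>..h \<alpha>}" if "\<alpha> \<in> {0<..1}" for \<alpha>
        using mono[of \<alpha> 1] le[of 1] that by auto
      have "connected ?U"
      proof (rule connected_Union[where S = "(\<lambda>\<alpha>. {l \<alpha>..h \<alpha>}) ` {0<..1}", simplified])
        show "(\<Inter>\<alpha>\<in>{0<..1}. {l \<alpha>..h \<alpha>}) \<noteq> {}" using mid by blast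
      qed auto
      moreover have "?U \<subseteq> {B..C}" using bound by force
      ultimately have "connected (closure ?U)" "compact (closure ?U)"
        by (auto simp: compact_closure connected_imp_connected_closure
            intro: bounded_subset[OF bounded_closed_interval])
      then obtain a b where ab: "closure ?U = {a..b}"
        using connected_compact_interval_1[of "closure ?U"] by (auto simp: box_real cbox_interval)
      moreover have "l 1 \<in> closure ?U" using mid[of 1] closure_subset by fastforce
      ultimately have "a \<le> b" by auto
      then show ?thesis using ab True pos by (auto simp: level_def)
    next
      case False
      then show ?thesis using lev1[of \<alpha>] le[of \<alpha>] a by auto
    qed
  qed
  then show ?thesis
    using lev1 by (intro exI[of _ "Abs_fuzzy_real Z"]) (simp add: lev_def Abs_fuzzy_real_inverse)
qed

section \<open>\<open>dbar\<close> as a complete metric\<close>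

lemma dbar_ge:
  assumes "\<alpha> \<in> {0<..1}"
  shows "\<bar>lo X \<alpha> - lo Y \<alpha>\<bar> \<le> dbar X Y" "\<bar>hi X \<alpha> - hi Y \<alpha>\<bar> \<le> dbar X Y"
  using cSUP_upper[OF assms dbar_bdd[of X Y]] by (auto simp: dbar_def)

lemma dbar_le:
  assumes "\<And>\<alpha>. \<alpha> \<in> {0<..1} \<Longrightarrow> \<bar>lo X \<alpha> - lo Y \<alpha>\<bar> \<le> c"
    and "\<And>\<alpha>. \<alpha> \<in> {0<..1} \<Longrightarrow> \<bar>hi X \<alpha> - hi Y \<alpha>\<bar> \<le> c"
  shows "dbar X Y \<le> c"
  unfolding dbar_def by (rule cSUP_least) (use assms in auto)

instantiation fuzzy_real :: metric_space
begin

definition "dist = dbar"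
definition "(uniformity :: (fuzzy_real \<times> fuzzy_real) filter) = (INF e\<in>{0<..}. principal {(x, y). dist x y < e})"
definition "open (U :: fuzzy_real set) \<longleftrightarrow> (\<forall>x\<in>U. eventually (\<lambda>(x', y). x' = x \<longrightarrow> y \<in> U) uniformity)"

instance
proof
  fix X Y Z :: fuzzy_real
  show "dist X Y = 0 \<longleftrightarrow> X = Y"
  proof
    assume d: "dist X Y = 0"
    show "X = Y"
    proof (rule fuzzy_real_eqI)
      fix \<alpha> :: real assume "0 < \<alpha>" "\<alpha> \<le> 1"
      then show "lev X \<alpha> = lev Y \<alpha>"
        using dbar_ge[of \<alpha> X Y] d lev_eq(1)[of \<alpha> X] lev_eq(1)[of \<alpha> Y] by (simp add: dist_fuzzy_real_def)
    qed
  qed (simp add: dist_fuzzy_real_def dbar_def)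
  show "dist X Y \<le> dist X Z + dist Y Z"
    unfolding dist_fuzzy_real_def
  proof (rule dbar_le)
    fix \<alpha> :: real assume a: "\<alpha> \<in> {0<..1}"
    show "\<bar>lo X \<alpha> - lo Y \<alpha>\<bar> \<le> dbar X Z + dbar Y Z"
      using dbar_ge(1)[OF a, of X Z] dbar_ge(1)[OF a, of Y Z] by linarith
    show "\<bar>hi X \<alpha> - hi Y \<alpha>\<bar> \<le> dbar X Z + dbar Y Z"
      using dbar_ge(2)[OF a, of X Z] dbar_ge(2)[OF a, of Y Z] by linarith
  qed
qed (rule uniformity_fuzzy_real_def open_fuzzy_real_def)+

end

text \<open>The endpoints of a Cauchy sequence converge at every level, uniformly in the level.
  Order and monotonicity pass to the limits pointwise, left continuity by uniformity, so the limit
  intervals are the levels of a fuzzy number.\<close>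

instance fuzzy_real :: complete_space
proof
  fix X :: "nat \<Rightarrow> fuzzy_real" assume C: "Cauchy X"
  define l where "l \<alpha> = lim (\<lambda>j. lo (X j) \<alpha>)" for \<alpha>
  define h where "h \<alpha> = lim (\<lambda>j. hi (X j) \<alpha>)" for \<alpha>
  have conv: "(\<lambda>j. lo (X j) \<alpha>) \<longlonglongrightarrow> l \<alpha>" "(\<lambda>j. hi (X j) \<alpha>) \<longlonglongrightarrow> h \<alpha>" if a: "\<alpha> \<in> {0<..1}" for \<alpha>
  proof -
    have "Cauchy (\<lambda>j. lo (X j) \<alpha>)" "Cauchy (\<lambda>j. hi (X j) \<alpha>)"
      using C dbar_ge[OF a] unfolding Cauchy_def dist_fuzzy_real_def dist_real_def
      by (meson le_less_trans)+
    then show "(\<lambda>j. lo (X j) \<alpha>) \<longlonglongrightarrow> l \<alpha>" "(\<lambda>j. hi (X j) \<alpha>) \<longlonglongrightarrow> h \<alpha>"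
      by (simp_all add: l_def h_def convergent_LIMSEQ_iff Cauchy_convergent_iff)
  qed
  \<comment> \<open>In the Cauchy estimate \<open>i\<close> tends to infinity while \<open>j\<close>
    stays fixed; \<open>N\<close> comes from \<open>dbar\<close> and so serves all levels at
    once.\<close>
  have unif: "\<exists>N. \<forall>j\<ge>N. \<forall>\<alpha>\<in>{0<..1}. \<bar>lo (X j) \<alpha> - l \<alpha>\<bar> \<le> e \<and> \<bar>hi (X j) \<alpha> - h \<alpha>\<bar> \<le> e" if "e > 0" for e
  proof -
    obtain N where N: "\<And>i j. i \<ge> N \<Longrightarrow> j \<ge> N \<Longrightarrow> dbar (X i) (X j) < e"
      using C \<open>e > 0\<close> unfolding Cauchy_def dist_fuzzy_real_def by blast
    have "\<bar>lo (X j) \<alpha> - l \<alpha>\<bar> \<le> e \<and> \<bar>hi (X j) \<alpha> - h \<alpha>\<bar> \<le> e" if j: "j \<ge> N" and a: "\<alpha> \<in> {0<..1}" for j \<alpha>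
    proof
      show "\<bar>lo (X j) \<alpha> - l \<alpha>\<bar> \<le> e"
      proof (rule LIMSEQ_le_const2)
        show "(\<lambda>i. \<bar>lo (X j) \<alpha> - lo (X i) \<alpha>\<bar>) \<longlonglongrightarrow> \<bar>lo (X j) \<alpha> - l \<alpha>\<bar>"
          by (intro tendsto_intros conv a)
        show "\<exists>M. \<forall>i\<ge>M. \<bar>lo (X j) \<alpha> - lo (X i) \<alpha>\<bar> \<le> e"
          using N[OF j] dbar_ge(1)[OF a, of "X j"] by (meson le_less_trans less_imp_le)
      qed
      show "\<bar>hi (X j) \<alpha> - h \<alpha>\<bar> \<le> e"
      proof (rule LIMSEQ_le_const2)
        show "(\<lambda>i. \<bar>hi (X j) \<alpha> - hi (X i) \<alpha>\<bar>) \<longlonglongrightarrow> \<bar>hi (X j) \<alpha> - h \<alpha>\<bar>"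
          by (intro tendsto_intros conv a)
        show "\<exists>M. \<forall>i\<ge>M. \<bar>hi (X j) \<alpha> - hi (X i) \<alpha>\<bar> \<le> e"
          using N[OF j] dbar_ge(2)[OF a, of "X j"] by (meson le_less_trans less_imp_le)
      qed
    qed
    then show ?thesis by blast
  qed
  \<comment> \<open>One term within 1 of the limit at every level: its level 0, widened by 1 on both
    sides, supplies the bounds for the limit intervals.\<close>
  obtain N1 where N1: "\<And>\<alpha>. \<alpha> \<in> {0<..1} \<Longrightarrow> \<bar>lo (X N1) \<alpha> - l \<alpha>\<bar> \<le> 1 \<and> \<bar>hi (X N1) \<alpha> - h \<alpha>\<bar> \<le> 1"
    using unif[OF zero_less_one] by (meson order_refl)
  have "\<exists>Z. \<forall>\<alpha>\<in>{0<..1}. lev Z \<alpha> = {l \<alpha>..h \<alpha>}"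
  proof (rule fuzzy_real_of_levels)
    fix \<alpha> :: real assume a: "0 < \<alpha>" "\<alpha> \<le> 1"
    show "l \<alpha> \<le> h \<alpha>"
      by (rule LIMSEQ_le[OF conv(1) conv(2)]) (use a lev_eq(2) in auto)
    show "lo (X N1) 0 - 1 \<le> l \<alpha> \<and> h \<alpha> \<le> hi (X N1) 0 + 1"
    proof -
      have "lev (X N1) \<alpha> \<subseteq> lev (X N1) 0"
        using a closure_subset[of "{t. Rep_fuzzy_real (X N1) t > 0}"] by (auto simp: lev_def level_def)
      then show ?thesis using lev_eq[of \<alpha> "X N1"] lev_eq[of 0 "X N1"] N1[of \<alpha>] a by auto
    qed
  next
    fix \<alpha> \<beta> :: real assume a: "0 < \<alpha>" "\<alpha> \<le> \<beta>" "\<beta> \<le> 1"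
    have "l \<alpha> \<le> l \<beta>" by (rule LIMSEQ_le[OF conv(1) conv(1)]) (use a lev_mono(1) in auto)
    moreover have "h \<beta> \<le> h \<alpha>" by (rule LIMSEQ_le[OF conv(2) conv(2)]) (use a lev_mono(2) in auto)
    ultimately show "l \<alpha> \<le> l \<beta> \<and> h \<beta> \<le> h \<alpha>" ..
  next
    fix \<alpha> t :: real assume a: "0 < \<alpha>" "\<alpha> \<le> 1"
      and t: "\<And>\<beta>. 0 < \<beta> \<Longrightarrow> \<beta> < \<alpha> \<Longrightarrow> t \<in> {l \<beta>..h \<beta>}"
    \<comment> \<open>The bounds at lower levels are moved to a single term \<open>X j\<close> at a
      cost of e/2, left continuity of its endpoints is applied, and the result is moved back to the
      limit for another e/2.\<close>
    have "l \<alpha> \<le> t + e \<and> t \<le> h \<alpha> + e" if "e > 0" for e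
    proof -
      obtain j where j: "\<And>\<beta>. \<beta> \<in> {0<..1} \<Longrightarrow> \<bar>lo (X j) \<beta> - l \<beta>\<bar> \<le> e / 2 \<and> \<bar>hi (X j) \<beta> - h \<beta>\<bar> \<le> e / 2"
        using unif[OF half_gt_zero[OF \<open>e > 0\<close>]] by (meson order_refl)
      have bd: "lo (X j) \<beta> \<le> t + e / 2 \<and> t - e / 2 \<le> hi (X j) \<beta>" if b: "0 < \<beta>" "\<beta> < \<alpha>" for \<beta>
      proof -
        have "\<bar>lo (X j) \<beta> - l \<beta>\<bar> \<le> e / 2" "\<bar>hi (X j) \<beta> - h \<beta>\<bar> \<le> e / 2" "l \<beta> \<le> t" "t \<le> h \<beta>"
          using j[of \<beta>] t[OF b] b a by auto
        then show ?thesis by linarith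
      qed
      have "lo (X j) \<alpha> \<le> t + e / 2" by (rule lo_left_continuous[OF a]) (use bd in blast)
      moreover have "t - e / 2 \<le> hi (X j) \<alpha>" by (rule hi_left_continuous[OF a]) (use bd in blast)
      moreover have "\<bar>lo (X j) \<alpha> - l \<alpha>\<bar> \<le> e / 2" "\<bar>hi (X j) \<alpha> - h \<alpha>\<bar> \<le> e / 2"
        using j[of \<alpha>] a by auto
      ultimately show ?thesis by linarith
    qed
    then show "t \<in> {l \<alpha>..h \<alpha>}" by (auto intro: field_le_epsilon)
  qed
  then obtain Z where Z: "\<And>\<alpha>. \<alpha> \<in> {0<..1} \<Longrightarrow> lev Z \<alpha> = {l \<alpha>..h \<alpha>}" by blast
  have lh: "lo Z \<alpha> = l \<alpha>" "hi Z \<alpha> = h \<alpha>" if a: "\<alpha> \<in> {0<..1}" for \<alpha>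
    using Z[OF a] lev_eq[of \<alpha> Z] a by auto
  have "X \<longlonglongrightarrow> Z"
  proof (rule metric_LIMSEQ_I)
    fix e :: real assume "e > 0"
    then obtain N where N: "\<And>j \<alpha>. j \<ge> N \<Longrightarrow> \<alpha> \<in> {0<..1} \<Longrightarrow> \<bar>lo (X j) \<alpha> - l \<alpha>\<bar> \<le> e / 2 \<and> \<bar>hi (X j) \<alpha> - h \<alpha>\<bar> \<le> e / 2"
      using unif[OF half_gt_zero[OF \<open>e > 0\<close>]] by meson
    have "dist (X j) Z \<le> e / 2" if "j \<ge> N" for j
      unfolding dist_fuzzy_real_def by (rule dbar_le) (use N[OF that] lh in auto)
    then show "\<exists>N. \<forall>j\<ge>N. dist (X j) Z < e" using \<open>e > 0\<close> by (intro exI[of _ N]) fastforce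
  qed
  then show "convergent X" by (auto simp: convergent_def)
qed

section \<open>Fuzzy subtraction and difference sequences\<close>

lemma lo_hi_diff:
  assumes "\<alpha> \<in> {0<..1}"
  shows "lo (X - Y) \<alpha> = lo X \<alpha> - hi Y \<alpha>" "hi (X - Y) \<alpha> = hi X \<alpha> - lo Y \<alpha>"
  using lev_diff[of \<alpha> X Y] lev_eq[of \<alpha> "X - Y"] lev_eq(2)[of \<alpha> X] lev_eq(2)[of \<alpha> Y] assms
  by auto

text \<open>Interval subtraction pairs a left end with a right end, but \<open>dbar\<close> controls
  both ends at every level.\<close>

lemma dist_diff_le: "dist (A - B) (C - D) \<le> dist A C + dist B (D :: fuzzy_real)"
  unfolding dist_fuzzy_real_def
proof (rule dbar_le)
  fix \<alpha> :: real assume a: "\<alpha> \<in> {0<..1}"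
  show "\<bar>lo (A - B) \<alpha> - lo (C - D) \<alpha>\<bar> \<le> dbar A C + dbar B D"
    unfolding lo_hi_diff[OF a] using dbar_ge[OF a, of A C] dbar_ge[OF a, of B D] by linarith
  show "\<bar>hi (A - B) \<alpha> - hi (C - D) \<alpha>\<bar> \<le> dbar A C + dbar B D"
    unfolding lo_hi_diff[OF a] using dbar_ge[OF a, of A C] dbar_ge[OF a, of B D] by linarith
qed

text \<open>Interval subtraction does not satisfy A - (A - B) = B. Nevertheless each end of
  \<open>B\<close> occurs in one end of \<open>A - B\<close>, as in hi (A - B) = hi A - lo B, so the
  differences of the ends can be solved for.\<close>

lemma dist_diff_cancel: "dist B D \<le> dist (A - B) (C - D) + dist A (C :: fuzzy_real)"
  unfolding dist_fuzzy_real_def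
proof (rule dbar_le)
  fix \<alpha> :: real assume a: "\<alpha> \<in> {0<..1}"
  note * = dbar_ge[OF a, of "A - B" "C - D", unfolded lo_hi_diff[OF a]] dbar_ge[OF a, of A C]
  show "\<bar>lo B \<alpha> - lo D \<alpha>\<bar> \<le> dbar (A - B) (C - D) + dbar A C"
    using * by linarith
  show "\<bar>hi B \<alpha> - hi D \<alpha>\<bar> \<le> dbar (A - B) (C - D) + dbar A C"
    using * by linarith
qed

lemma tendsto_fuzzy_diff:
  fixes a b :: fuzzy_real
  assumes "(f \<longlongrightarrow> a) F" "(g \<longlongrightarrow> b) F"
  shows "((\<lambda>x. f x - g x) \<longlongrightarrow> a - b) F"
proof (rule tendstoI)
  fix e :: real assume "e > 0"
  then have "\<forall>\<^sub>F x in F. dist (f x) a < e / 2" "\<forall>\<^sub>F x in F. dist (g x) b < e / 2"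
    using tendstoD[OF assms(1), of "e / 2"] tendstoD[OF assms(2), of "e / 2"] by auto
  then show "\<forall>\<^sub>F x in F. dist (f x - g x) (a - b) < e"
  proof eventually_elim
    case (elim x)
    then show ?case using dist_diff_le[of "f x" "g x" a b] by linarith
  qed
qed

lemma Cauchy_fuzzy_diff:
  fixes A B :: "nat \<Rightarrow> fuzzy_real"
  assumes "Cauchy A" "Cauchy B"
  shows "Cauchy (\<lambda>i. A i - B i)"
  using assms unfolding Cauchy_convergent_iff convergent_def by (blast intro: tendsto_fuzzy_diff)

lemma Cauchy_fuzzy_cancel:
  fixes A B :: "nat \<Rightarrow> fuzzy_real"
  assumes "Cauchy A" "Cauchy (\<lambda>i. A i - B i)"
  shows "Cauchy B"
proof (rule metric_CauchyI)
  fix e :: real assume "e > 0"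
  obtain K where K: "\<And>i j. i \<ge> K \<Longrightarrow> j \<ge> K \<Longrightarrow> dist (A i) (A j) < e / 2"
    using metric_CauchyD[OF assms(1), of "e / 2"] \<open>e > 0\<close> by auto
  obtain L where L: "\<And>i j. i \<ge> L \<Longrightarrow> j \<ge> L \<Longrightarrow> dist (A i - B i) (A j - B j) < e / 2"
    using metric_CauchyD[OF assms(2), of "e / 2"] \<open>e > 0\<close> by auto
  have "dist (B i) (B j) < e" if "i \<ge> max K L" "j \<ge> max K L" for i j
    using K[of i j] L[of i j] dist_diff_cancel[of "B i" "B j" "A i" "A j"] that by auto
  then show "\<exists>N. \<forall>i\<ge>N. \<forall>j\<ge>N. dist (B i) (B j) < e" by blast
qed

lemma fuzzy_diff_cancel: "A - B = A - D \<Longrightarrow> B = (D :: fuzzy_real)"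
  using dist_diff_cancel[of B D A A] by simp

lemma fdiff_0 [simp]: "fdiff 0 n X = X"
  by (cases n) auto

text \<open>Q is a property of families of fuzzy numbers. The instances are agreement of two numbers
  (for injectivity) and being Cauchy.\<close>

lemma fdiff_closed:
  assumes diff: "\<And>A B. Q A \<Longrightarrow> Q B \<Longrightarrow> Q (\<lambda>i. A i - B i)"
    and ini: "\<And>r. r \<le> k + m * n \<Longrightarrow> Q (\<lambda>i. \<sigma> i r)"
  shows "Q (\<lambda>i. fdiff m n (\<sigma> i) k)"
  using ini
proof (induction n arbitrary: k)
  case (Suc n)
  show ?case
  proof (cases "m = 0")
    case False
    have "Q (\<lambda>i. fdiff m n (\<sigma> i) k)" "Q (\<lambda>i. fdiff m n (\<sigma> i) (k + m))"
      by (rule Suc.IH; rule Suc.prems; simp)+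
    then show ?thesis using False diff by simp
  qed (use Suc.prems in simp)
qed simp

text \<open>Induction on the order of the difference. In the step, the difference of order
  \<open>n\<close> at index \<open>j\<close> is recovered by cancellation from the one at
  \<open>j - m\<close> and the difference of order \<open>Suc n\<close> at \<open>j - m\<close>,
  starting from the indices below \<open>m\<close>.\<close>

lemma fdiff_cancel:
  assumes diff: "\<And>A B. Q A \<Longrightarrow> Q B \<Longrightarrow> Q (\<lambda>i. A i - B i)"
    and cancel: "\<And>A B. Q A \<Longrightarrow> Q (\<lambda>i. A i - B i) \<Longrightarrow> Q B"
    and ini: "\<And>r. r < m * n \<Longrightarrow> Q (\<lambda>i. \<sigma> i r)"
    and fd: "\<And>k. Q (\<lambda>i. fdiff m n (\<sigma> i) k)"
  shows "Q (\<lambda>i. \<sigma> i k)"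
  using ini fd
proof (induction n arbitrary: k)
  case (Suc n)
  show ?case
  proof (cases "m = 0")
    case False
    have "Q (\<lambda>i. fdiff m n (\<sigma> i) j)" for j
    proof (induction j rule: less_induct)
      case (less j)
      show ?case
      proof (cases "j < m")
        case True
        \<comment> \<open>For j < m only terms up to index j + m * n, which is below m * Suc n,
          enter. This explains why the metrics contain exactly the first mn terms.\<close>
        show ?thesis by (rule fdiff_closed[where Q = Q, OF diff]) (use True Suc.prems(1) in auto)
      next
        case ge: False
        then have "Q (\<lambda>i. fdiff m n (\<sigma> i) (j - m))" using False by (intro less) auto
        moreover have "Q (\<lambda>i. fdiff m n (\<sigma> i) (j - m) - fdiff m n (\<sigma> i) j)"
          using Suc.prems(2)[of "j - m"] False ge by simp
        ultimately show ?thesis by (rule cancel)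
      qed
    qed
    then show ?thesis by (rule Suc.IH[rotated]) (use Suc.prems(1) in simp)
  qed (use Suc.prems in simp)
qed simp

lemma fdiff_inject:
  assumes "\<And>r. r < m * n \<Longrightarrow> X r = Y r" "\<And>k. fdiff m n X k = fdiff m n Y k"
  shows "X = Y"
proof
  fix k
  \<comment> \<open>The index type is \<open>bool\<close>: a family is a pair, and \<open>Q\<close>
    says that its two members coincide.\<close>
  show "X k = Y k"
    using fdiff_cancel[where Q = "\<lambda>A. A True = A False" and \<sigma> = "\<lambda>b. if b then X else Y"
        and m = m and n = n and k = k] assms fuzzy_diff_cancel by auto
qed

lemma tendsto_fdiff:
  assumes "\<And>k. ((\<lambda>i. \<sigma> i k) \<longlongrightarrow> X k) F"
  shows "((\<lambda>i. fdiff m n (\<sigma> i) k) \<longlongrightarrow> fdiff m n X k) F"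
  by (induction n arbitrary: k) (auto intro: tendsto_fuzzy_diff assms)

section \<open>Gauges of convex functionals\<close>

text \<open>The bound on w in place of an equation makes F monotone as well as convex.\<close>

definition cone_convex :: "((nat \<Rightarrow> real) \<Rightarrow> real) \<Rightarrow> bool" where
  "cone_convex F \<longleftrightarrow> F (\<lambda>_. 0) = 0
     \<and> (\<forall>t u v w. 0 \<le> t \<longrightarrow> t \<le> 1 \<longrightarrow> (\<forall>k. 0 \<le> u k) \<longrightarrow> (\<forall>k. 0 \<le> v k) \<longrightarrow> (\<forall>k. 0 \<le> w k)
          \<longrightarrow> (\<forall>k. w k \<le> t * u k + (1 - t) * v k) \<longrightarrow> F w \<le> t * F u + (1 - t) * F v)
     \<and> (\<forall>u v. (\<forall>j k. 0 \<le> u j k) \<longrightarrow> (\<forall>k. (\<lambda>j. u j k) \<longlonglongrightarrow> v k) \<longrightarrow> (\<lambda>j :: nat. F (u j)) \<longlonglongrightarrow> F v)"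

lemma cone_convex_zero: "cone_convex F \<Longrightarrow> F (\<lambda>_. 0) = 0"
  by (simp add: cone_convex_def)

lemma cone_convexD:
  assumes "cone_convex F" "0 \<le> t" "t \<le> 1" "\<And>k. 0 \<le> u k" "\<And>k. 0 \<le> v k" "\<And>k. 0 \<le> w k"
    and "\<And>k. w k \<le> t * u k + (1 - t) * v k"
  shows "F w \<le> t * F u + (1 - t) * F v"
  using assms by (simp add: cone_convex_def)

lemma cone_convex_tendsto:
  assumes "cone_convex F" "\<And>j k. 0 \<le> u j k" "\<And>k. (\<lambda>j. u j k) \<longlonglongrightarrow> v k"
  shows "(\<lambda>j :: nat. F (u j)) \<longlonglongrightarrow> F v"
  using assms by (simp add: cone_convex_def)

text \<open>Monotonicity against the zero sequence: weight t = 1 and w = 0.\<close>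

lemma cone_convex_nonneg:
  assumes "cone_convex F" "\<And>k. 0 \<le> u k"
  shows "0 \<le> F u"
  using cone_convexD[OF assms(1), of 1 u u "\<lambda>_. 0"] assms cone_convex_zero[OF assms(1)] by simp

lemma cone_convexI:
  assumes "F (\<lambda>_. 0) = 0"
    and "\<And>t u v w. 0 \<le> t \<Longrightarrow> t \<le> 1 \<Longrightarrow> (\<And>k. 0 \<le> u k) \<Longrightarrow> (\<And>k. 0 \<le> v k) \<Longrightarrow> (\<And>k. 0 \<le> w k)
          \<Longrightarrow> (\<And>k. w k \<le> t * u k + (1 - t) * v k) \<Longrightarrow> F w \<le> t * F u + (1 - t) * F v"
    and "\<And>u v. (\<And>j k. 0 \<le> u j k) \<Longrightarrow> (\<And>k. (\<lambda>j. u j k) \<longlonglongrightarrow> v k) \<Longrightarrow> (\<lambda>j :: nat. F (u j)) \<longlonglongrightarrow> F v"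
  shows "cone_convex F"
  using assms unfolding cone_convex_def by blast

lemma cone_convex_coord: "cone_convex (\<lambda>u. u k)"
  by (rule cone_convexI) auto

lemma cone_convex_cmult:
  assumes F: "cone_convex F" and c: "0 \<le> c"
  shows "cone_convex (\<lambda>u. c * F u)"
proof (rule cone_convexI)
  fix t :: real and u v w :: "nat \<Rightarrow> real"
  assume "0 \<le> t" "t \<le> 1" "\<And>k. 0 \<le> u k" "\<And>k. 0 \<le> v k" "\<And>k. 0 \<le> w k"
    "\<And>k. w k \<le> t * u k + (1 - t) * v k"
  then have "c * F w \<le> c * (t * F u + (1 - t) * F v)"
    by (intro mult_left_mono cone_convexD[OF F] c)
  then show "c * F w \<le> t * (c * F u) + (1 - t) * (c * F v)"
    by (simp add: algebra_simps)
next
  fix u :: "nat \<Rightarrow> nat \<Rightarrow> real" and v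
  assume "\<And>j k. 0 \<le> u j k" "\<And>k. (\<lambda>j. u j k) \<longlonglongrightarrow> v k"
  then show "(\<lambda>j. c * F (u j)) \<longlonglongrightarrow> c * F v"
    by (intro tendsto_mult_left cone_convex_tendsto[OF F])
qed (simp add: cone_convex_zero[OF F])

lemma cone_convex_sum:
  assumes F: "\<And>i. i \<in> I \<Longrightarrow> cone_convex (F i)"
  shows "cone_convex (\<lambda>u. \<Sum>i\<in>I. F i u)"
proof (rule cone_convexI)
  fix t :: real and u v w :: "nat \<Rightarrow> real"
  assume "0 \<le> t" "t \<le> 1" "\<And>k. 0 \<le> u k" "\<And>k. 0 \<le> v k" "\<And>k. 0 \<le> w k"
    "\<And>k. w k \<le> t * u k + (1 - t) * v k"
  then have "(\<Sum>i\<in>I. F i w) \<le> (\<Sum>i\<in>I. t * F i u + (1 - t) * F i v)"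
    by (intro sum_mono cone_convexD[OF F])
  then show "(\<Sum>i\<in>I. F i w) \<le> t * (\<Sum>i\<in>I. F i u) + (1 - t) * (\<Sum>i\<in>I. F i v)"
    by (simp add: sum.distrib sum_distrib_left)
next
  fix u :: "nat \<Rightarrow> nat \<Rightarrow> real" and v
  assume "\<And>j k. 0 \<le> u j k" "\<And>k. (\<lambda>j. u j k) \<longlonglongrightarrow> v k"
  then show "(\<lambda>j. \<Sum>i\<in>I. F i (u j)) \<longlonglongrightarrow> (\<Sum>i\<in>I. F i v)"
    by (intro tendsto_sum cone_convex_tendsto[OF F])
qed (simp add: cone_convex_zero[OF F])

text \<open>The library version excludes the endpoint 0.\<close>

lemma powr_convex_nonneg:
  fixes x y t p :: real
  assumes p: "1 \<le> p" and t: "0 \<le> t" "t \<le> 1" and xy: "0 \<le> x" "0 \<le> y"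
  shows "(t * x + (1 - t) * y) powr p \<le> t * x powr p + (1 - t) * y powr p"
proof -
  \<comment> \<open>For s in [0,1] and p at least 1, s^p is at most s; this handles the cases where
    one of the two points is 0.\<close>
  have scale: "(s * z) powr p \<le> s * z powr p" if "0 \<le> s" "s \<le> 1" "0 \<le> z" for s z :: real
  proof (cases "s = 0")
    case False
    then have "s powr p \<le> s" using that p by (intro powr_le_one_le) auto
    then show ?thesis using that by (simp add: powr_mult mult_right_mono)
  qed simp
  consider "x = 0" | "y = 0" | "x > 0" "y > 0" using xy by linarith
  then show ?thesis
  proof cases
    case 3
    then show ?thesis
      using convex_onD[OF powr_convex[OF p], of "1 - t" x y] t by simp
  qed (use scale[of "1 - t" y] scale[of t x] t xy p in simp_all)
qed

text \<open>The p-th power is increasing and convex on the nonnegative reals, so composing with it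
  keeps monotonicity and convexity.\<close>

lemma cone_convex_powr:
  assumes F: "cone_convex F" and p: "1 \<le> p"
  shows "cone_convex (\<lambda>u. F u powr p)"
proof (rule cone_convexI)
  fix t :: real and u v w :: "nat \<Rightarrow> real"
  assume *: "0 \<le> t" "t \<le> 1" "\<And>k. 0 \<le> u k" "\<And>k. 0 \<le> v k" "\<And>k. 0 \<le> w k"
    "\<And>k. w k \<le> t * u k + (1 - t) * v k"
  then have "F w \<le> t * F u + (1 - t) * F v" by (intro cone_convexD[OF F])
  then have "F w powr p \<le> (t * F u + (1 - t) * F v) powr p"
    using p cone_convex_nonneg[OF F *(5)] by (intro powr_mono2) auto
  also have "\<dots> \<le> t * F u powr p + (1 - t) * F v powr p"
    by (intro powr_convex_nonneg p * cone_convex_nonneg[OF F])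
  finally show "F w powr p \<le> t * F u powr p + (1 - t) * F v powr p" .
next
  fix u :: "nat \<Rightarrow> nat \<Rightarrow> real" and v
  assume *: "\<And>j k. 0 \<le> u j k" "\<And>k. (\<lambda>j. u j k) \<longlonglongrightarrow> v k"
  show "(\<lambda>j. F (u j) powr p) \<longlonglongrightarrow> F v powr p"
  proof (rule tendsto_powr')
    show "(\<lambda>j. F (u j)) \<longlonglongrightarrow> F v" by (intro cone_convex_tendsto[OF F] *)
    \<comment> \<open>The second alternative secures continuity also at base 0.\<close>
    show "F v \<noteq> 0 \<or> 0 < p \<and> (\<forall>\<^sub>F j in sequentially. 0 \<le> F (u j))"
      using p cone_convex_nonneg[OF F *(1)] by simp
  qed auto
qed (simp add: cone_convex_zero[OF F])

lemmas cone_convex_intros =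
  cone_convex_coord cone_convex_cmult cone_convex_sum cone_convex_powr

section \<open>Orlicz functions\<close>

context
  fixes M :: "real \<Rightarrow> real"
  assumes M: "orlicz M"
begin

lemma orlicz_zero: "M 0 = 0"
  using M by (simp add: orlicz_def)

lemma orlicz_pos: "0 < x \<Longrightarrow> 0 < M x"
  using M by (simp add: orlicz_def)

lemma orlicz_nonneg: "0 \<le> x \<Longrightarrow> 0 \<le> M x"
  using orlicz_zero orlicz_pos[of x] by (cases "x = 0") auto

lemma orlicz_mono: "0 \<le> x \<Longrightarrow> x \<le> y \<Longrightarrow> M x \<le> M y"
  using M by (auto simp: orlicz_def intro: mono_onD[of "{0..}" M])

lemma orlicz_tendsto:
  assumes "\<And>j. 0 \<le> u j" "u \<longlonglongrightarrow> x"
  shows "(\<lambda>j. M (u j)) \<longlonglongrightarrow> M x"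
proof -
  have "0 \<le> x" using assms by (intro LIMSEQ_le_const) auto
  moreover have "continuous_on {0..} M" using M by (simp add: orlicz_def)
  ultimately show ?thesis
    using assms by (intro continuous_on_tendsto_compose[of "{0..}" M u x]) auto
qed

text \<open>\<open>M\<close> tends to infinity. In this form a bound on the functionals becomes a
  bound on distances.\<close>

lemma orlicz_le_bound: "\<exists>K. \<forall>x. M x \<le> C \<longrightarrow> x \<le> K"
proof -
  have "\<forall>\<^sub>F x in at_top. C < M x"
    using M by (simp add: orlicz_def filterlim_at_top_dense)
  then obtain K where "\<And>x. K \<le> x \<Longrightarrow> C < M x" by (auto simp: eventually_at_top_linorder)
  then show ?thesis by (intro exI[of _ K]) (meson linorder_not_le nle_le)
qed

text \<open>The classical Luxemburg estimate: (a + b)/(\<rho> + \<sigma>) is the convex combination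
  of a/\<rho> and b/\<sigma> with weights \<rho>/(\<rho> + \<sigma>) and \<sigma>/(\<rho> +
  \<sigma>).\<close>

lemma orlicz_scaled_add:
  assumes "0 < \<rho>" "0 < \<sigma>" "0 \<le> a" "0 \<le> b" "0 \<le> c" "c \<le> a + b"
  shows "M (c / (\<rho> + \<sigma>)) \<le> \<rho> / (\<rho> + \<sigma>) * M (a / \<rho>) + (1 - \<rho> / (\<rho> + \<sigma>)) * M (b / \<sigma>)"
proof -
  have "convex_on {0..} M" using M by (simp add: orlicz_def)
  from convex_onD[OF this, of "1 - \<rho> / (\<rho> + \<sigma>)" "a / \<rho>" "b / \<sigma>"]
  have "M (\<rho> / (\<rho> + \<sigma>) * (a / \<rho>) + (1 - \<rho> / (\<rho> + \<sigma>)) * (b / \<sigma>))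
      \<le> \<rho> / (\<rho> + \<sigma>) * M (a / \<rho>) + (1 - \<rho> / (\<rho> + \<sigma>)) * M (b / \<sigma>)"
    using assms by simp
  moreover have "\<rho> / (\<rho> + \<sigma>) * (a / \<rho>) + (1 - \<rho> / (\<rho> + \<sigma>)) * (b / \<sigma>) = (a + b) / (\<rho> + \<sigma>)"
  proof -
    have "1 - \<rho> / (\<rho> + \<sigma>) = \<sigma> / (\<rho> + \<sigma>)" using assms by (simp add: field_simps)
    then show ?thesis using assms by (simp add: add_divide_distrib)
  qed
  moreover have "M (c / (\<rho> + \<sigma>)) \<le> M ((a + b) / (\<rho> + \<sigma>))"
    using assms by (intro orlicz_mono divide_right_mono) auto
  ultimately show ?thesis by simp
qed

end

section \<open>From extended-valued to real-valued complete metrics\<close>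

lemma ennreal_dense_pos:
  fixes \<epsilon> :: ennreal
  assumes "0 < \<epsilon>"
  shows "\<exists>e>0. ennreal e < \<epsilon>"
proof (cases \<epsilon>)
  case (real r)
  then show ?thesis using assms by (intro exI[of _ "r / 2"]) (auto simp: ennreal_less_iff)
next
  case top
  then show ?thesis by (intro exI[of _ 1]) (simp add: ennreal_less_top)
qed

text \<open>Finiteness makes the coercion to the reals faithful on \<open>S\<close>, so the axioms,
  Cauchy sequences and limits carry over. Symmetry is assumed for all points because
  \<open>Metric_space\<close> demands it outside the carrier as well.\<close>

lemma complete_metric_onI:
  assumes ext: "complete_extended_metric_on S f"
    and sym: "\<And>x y. f x y = f y x"
    and fin: "\<And>x y. x \<in> S \<Longrightarrow> y \<in> S \<Longrightarrow> f x y < \<infinity>"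
  shows "complete_metric_on S f"
proof -
  let ?d = "\<lambda>x y. enn2real (f x y)"
  have eq: "f x y = ennreal (?d x y)" if "x \<in> S" "y \<in> S" for x y
    using fin[OF that] by simp
  interpret Metric_space S ?d
  proof
    fix x y z assume S: "x \<in> S" "y \<in> S" "z \<in> S"
    then show "?d x y = 0 \<longleftrightarrow> x = y"
      using ext fin[of x y] by (auto simp: complete_extended_metric_on_def enn2real_eq_0_iff)
    have "f x z \<le> f x y + f y z" using ext S by (simp add: complete_extended_metric_on_def)
    then have "ennreal (?d x z) \<le> ennreal (?d x y + ?d y z)" using eq S by simp
    then show "?d x z \<le> ?d x y + ?d y z" by (simp add: ennreal_le_iff del: ennreal_plus)
  qed (simp_all add: sym)
  have "mcomplete"
    unfolding mcomplete_def
  proof (intro allI impI)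
    fix \<sigma> assume C: "MCauchy \<sigma>"
    then have S: "range \<sigma> \<subseteq> S" by (simp add: MCauchy_def)
    have "\<exists>N. \<forall>i\<ge>N. \<forall>j\<ge>N. f (\<sigma> i) (\<sigma> j) < \<epsilon>" if "\<epsilon> > 0" for \<epsilon>
    proof -
      obtain e where e: "0 < e" "ennreal e < \<epsilon>"
        using ennreal_dense_pos[OF \<open>\<epsilon> > 0\<close>] by blast
      obtain N where N: "\<And>i j. N \<le> i \<Longrightarrow> N \<le> j \<Longrightarrow> ?d (\<sigma> i) (\<sigma> j) < e"
        using C e(1) unfolding MCauchy_def by blast
      have "f (\<sigma> i) (\<sigma> j) < \<epsilon>" if "N \<le> i" "N \<le> j" for i j
      proof -
        have "f (\<sigma> i) (\<sigma> j) = ennreal (?d (\<sigma> i) (\<sigma> j))" using S by (intro eq) auto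
        also have "\<dots> \<le> ennreal e" using N[OF that] by (intro ennreal_leI) simp
        finally show ?thesis using e(2) by simp
      qed
      then show ?thesis by blast
    qed
    then obtain x where x: "x \<in> S" "(\<lambda>i. f (\<sigma> i) x) \<longlonglongrightarrow> 0"
      using ext S unfolding complete_extended_metric_on_def by meson
    have "(\<lambda>i. ?d (\<sigma> i) x) \<longlonglongrightarrow> 0"
      using tendsto_enn2real[of "\<lambda>i. f (\<sigma> i) x" 0 sequentially] x(2) by simp
    then have "limitin mtopology \<sigma> x sequentially"
      unfolding limitin_metric_dist_null using x(1) range_subsetD[OF S] by simp
    then show "\<exists>x. limitin mtopology \<sigma> x sequentially" ..
  qed
  then show ?thesis
    using fin Metric_space_axioms by (simp add: complete_metric_on_def)
qed

text \<open>The condition of being at most 1 is imposed on countably many functionals, so that an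
  infinite sum or a supremum can be replaced by finite expressions that are continuous
  coordinatewise. \<open>coord_bound\<close>, with a bound depending on \<open>k\<close>, lets the
  gauge separate points and makes Cauchy sequences Cauchy in each coordinate.\<close>

locale gauge_family =
  fixes M :: "real \<Rightarrow> real" and F :: "nat \<Rightarrow> (nat \<Rightarrow> real) \<Rightarrow> real"
  assumes orlicz: "orlicz M"
    and cone_convex: "cone_convex (F N)"
    and coord_bound: "\<exists>C. \<forall>u. (\<forall>k. 0 \<le> u k) \<longrightarrow> (\<forall>N. F N u \<le> 1) \<longrightarrow> u k \<le> C"
begin

definition admissible :: "real \<Rightarrow> (nat \<Rightarrow> real) \<Rightarrow> bool" where
  "admissible \<rho> u \<longleftrightarrow> \<rho> > 0 \<and> (\<forall>N. F N (\<lambda>k. M (u k / \<rho>)) \<le> 1)"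

text \<open>The triangle inequality before infima are taken: convexity of \<open>M\<close> at each
  coordinate, then convexity of each \<open>F N\<close>, both with weight \<rho>/(\<rho> +
  \<sigma>).\<close>

lemma admissible_add:
  assumes u: "admissible \<rho> u" "\<And>k. 0 \<le> u k" and v: "admissible \<sigma> v" "\<And>k. 0 \<le> v k"
    and w: "\<And>k. 0 \<le> w k" "\<And>k. w k \<le> u k + v k"
  shows "admissible (\<rho> + \<sigma>) w"
proof -
  have pos: "0 < \<rho>" "0 < \<sigma>" using u v by (auto simp: admissible_def)
  let ?t = "\<rho> / (\<rho> + \<sigma>)"
  have t: "0 \<le> ?t" "?t \<le> 1" using pos by auto
  have "F N (\<lambda>k. M (w k / (\<rho> + \<sigma>))) \<le> 1" for N
  proof -
    have "F N (\<lambda>k. M (w k / (\<rho> + \<sigma>)))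
        \<le> ?t * F N (\<lambda>k. M (u k / \<rho>)) + (1 - ?t) * F N (\<lambda>k. M (v k / \<sigma>))"
      using pos u(2) v(2) w
      by (intro cone_convexD[OF cone_convex] t orlicz_nonneg[OF orlicz] orlicz_scaled_add[OF orlicz]) auto
    also have "\<dots> \<le> ?t * 1 + (1 - ?t) * 1"
      using u(1) v(1) t by (intro add_mono mult_left_mono) (auto simp: admissible_def)
    finally show ?thesis by simp
  qed
  then show ?thesis using pos by (simp add: admissible_def)
qed

lemma admissible_zero: "0 < \<rho> \<Longrightarrow> admissible \<rho> (\<lambda>_. 0)"
  by (simp add: admissible_def orlicz_zero[OF orlicz] cone_convex_zero[OF cone_convex])

text \<open>The zero sequence is admissible at scale \<sigma> - \<rho>, and adding it raises the
  scale.\<close>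

lemma admissible_mono:
  assumes "admissible \<rho> u" "\<And>k. 0 \<le> u k" "\<rho> \<le> \<sigma>"
  shows "admissible \<sigma> u"
proof (cases "\<rho> = \<sigma>")
  case False
  then show ?thesis
    using admissible_add[OF assms(1,2) admissible_zero[of "\<sigma> - \<rho>"], of u] assms by simp
qed (use assms in simp)

text \<open>\<open>coord_bound\<close> bounds M (u k / \<rho>), hence u k / \<rho>, by a constant
  independent of \<rho> and \<open>u\<close>. Being linear in \<rho>, the estimate turns small
  scales into small coordinates.\<close>

lemma admissible_coord_bound:
  "\<exists>K>0. \<forall>\<rho> u. (\<forall>k. 0 \<le> u k) \<longrightarrow> admissible \<rho> u \<longrightarrow> u k \<le> \<rho> * K"
proof -
  obtain C where C: "\<And>u. (\<And>k. 0 \<le> u k) \<Longrightarrow> (\<And>N. F N u \<le> 1) \<Longrightarrow> u k \<le> C"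
    using coord_bound by blast
  obtain K where K: "\<And>x. M x \<le> C \<Longrightarrow> x \<le> K"
    using orlicz_le_bound[OF orlicz] by blast
  have "u k \<le> \<rho> * max K 1" if u: "\<And>k. 0 \<le> u k" and adm: "admissible \<rho> u" for u \<rho>
  proof -
    have \<rho>: "0 < \<rho>" using adm by (simp add: admissible_def)
    have "M (u k / \<rho>) \<le> C"
      using adm u \<rho> by (intro C orlicz_nonneg[OF orlicz]) (auto simp: admissible_def)
    then have "u k / \<rho> \<le> K" by (rule K)
    then have "u k / \<rho> \<le> max K 1" by simp
    then show ?thesis using \<rho> by (simp add: pos_divide_le_eq mult.commute)
  qed
  then show ?thesis by (intro exI[of _ "max K 1"]) auto
qed

text \<open>A lower semicontinuity statement in the manner of Fatou: each single inequality is
  continuous in the sequence, so all of them survive in the limit at the same scale.\<close>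

lemma admissible_limit:
  assumes "\<And>j k. 0 \<le> u j k" "\<And>k. (\<lambda>j. u j k) \<longlonglongrightarrow> v k" "\<And>j :: nat. admissible \<rho> (u j)"
  shows "admissible \<rho> v"
proof -
  have \<rho>: "0 < \<rho>" using assms(3) by (simp add: admissible_def)
  have "F N (\<lambda>k. M (v k / \<rho>)) \<le> 1" for N
  proof (rule LIMSEQ_le_const2)
    show "(\<lambda>j. F N (\<lambda>k. M (u j k / \<rho>))) \<longlonglongrightarrow> F N (\<lambda>k. M (v k / \<rho>))"
      using \<rho> assms(1,2)
      by (intro cone_convex_tendsto[OF cone_convex] orlicz_nonneg[OF orlicz]
          orlicz_tendsto[OF orlicz] tendsto_divide tendsto_const) auto
    show "\<exists>N'. \<forall>j\<ge>N'. F N (\<lambda>k. M (u j k / \<rho>)) \<le> 1"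
      using assms(3) by (auto simp: admissible_def)
  qed
  then show ?thesis using \<rho> by (simp add: admissible_def)
qed

text \<open>By convexity and M 0 = 0, enlarging the scale by a factor c divides the functionals by
  at least c; c = max B 1 brings the bound \<open>B\<close> down to 1. This links membership in a
  space to finiteness of the gauge.\<close>

lemma admissible_of_bounded:
  assumes u: "\<And>k. 0 \<le> u k" and \<rho>: "0 < \<rho>" and B: "\<And>N. F N (\<lambda>k. M (u k / \<rho>)) \<le> B"
  shows "\<exists>\<sigma>. admissible \<sigma> u"
proof -
  define c where "c = max B 1"
  have c: "1 \<le> c" "B \<le> c" by (auto simp: c_def)
  \<comment> \<open>The second summand is 0 with scale (c - 1) * \<rho>, so that the scales add up
    to c * \<rho>. That scale must be positive, whence the separate case c = 1.\<close>
  have scale: "M (u k / (c * \<rho>)) \<le> 1 / c * M (u k / \<rho>) + (1 - 1 / c) * 0" for k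
  proof (cases "c = 1")
    case False
    then show ?thesis
      using orlicz_scaled_add[OF orlicz, of \<rho> "(c - 1) * \<rho>" "u k" 0 "u k"] u[of k] \<rho> c
      by (simp add: algebra_simps orlicz_zero[OF orlicz])
  qed simp
  have "F N (\<lambda>k. M (u k / (c * \<rho>))) \<le> 1" for N
  proof -
    have "F N (\<lambda>k. M (u k / (c * \<rho>))) \<le> 1 / c * F N (\<lambda>k. M (u k / \<rho>)) + (1 - 1 / c) * F N (\<lambda>_. 0)"
      using c \<rho> u scale by (intro cone_convexD[OF cone_convex] orlicz_nonneg[OF orlicz]) auto
    also have "\<dots> \<le> 1 / c * c"
      using c order_trans[OF B c(2)] by (simp add: cone_convex_zero[OF cone_convex] divide_right_mono)
    finally show ?thesis using c by simp
  qed
  then show ?thesis using \<rho> c by (auto simp: admissible_def intro!: exI[of _ "c * \<rho>"])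
qed

text \<open>The Luxemburg gauge; in \<open>ennreal\<close> the infimum over an empty set of scales
  is infinite.\<close>

definition gap :: "(nat \<Rightarrow> real) \<Rightarrow> ennreal" where
  "gap u = (INF \<rho>\<in>{\<rho>. admissible \<rho> u}. ennreal \<rho>)"

lemma gap_le: "admissible \<rho> u \<Longrightarrow> gap u \<le> ennreal \<rho>"
  unfolding gap_def by (rule INF_lower) simp

lemma admissible_of_gap_less:
  assumes "gap u < ennreal \<rho>" "\<And>k. 0 \<le> u k"
  shows "admissible \<rho> u"
proof -
  obtain \<sigma> where \<sigma>: "admissible \<sigma> u" "ennreal \<sigma> < ennreal \<rho>"
    using assms(1) unfolding gap_def INF_less_iff by auto
  then have "\<sigma> \<le> \<rho>" by (meson ennreal_leI leD le_cases)
  then show ?thesis using \<sigma> assms(2) admissible_mono by blast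
qed

lemma admissible_of_gap_finite:
  assumes "gap u < \<infinity>" "\<And>k. 0 \<le> u k"
  shows "\<exists>\<rho>. admissible \<rho> u"
  using assms(1) unfolding gap_def INF_less_iff by auto

lemma gap_triangle:
  assumes u: "\<And>k. 0 \<le> u k" and v: "\<And>k. 0 \<le> v k"
    and w: "\<And>k. 0 \<le> w k" "\<And>k. w k \<le> u k + v k"
  shows "gap w \<le> gap u + gap v"
proof (rule ennreal_le_epsilon)
  fix e :: real assume fin: "gap u + gap v < top" and e: "0 < e"
  obtain a b where a: "0 \<le> a" "gap u = ennreal a" and b: "0 \<le> b" "gap v = ennreal b"
    using fin by (cases "gap u"; cases "gap v") auto
  \<comment> \<open>Adding e/2 puts the scale strictly above the gauge, which makes it admissible
    even when the gauge is 0.\<close>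
  have "admissible (a + e / 2) u" "admissible (b + e / 2) v"
    using a b e u v by (auto intro!: admissible_of_gap_less simp: ennreal_less_iff)
  then have "admissible (a + e / 2 + (b + e / 2)) w"
    by (rule admissible_add[OF _ u _ v w])
  then have "gap w \<le> ennreal (a + e / 2 + (b + e / 2))" by (rule gap_le)
  also have "\<dots> = gap u + gap v + ennreal e"
    using a b e by (simp add: ennreal_plus[symmetric] del: ennreal_plus)
  finally show "gap w \<le> gap u + gap v + ennreal e" .
qed

lemma gap_zero: "gap (\<lambda>_. 0) = 0"
proof (rule antisym)
  show "gap (\<lambda>_. 0) \<le> 0"
  proof (rule ennreal_le_epsilon)
    fix e :: real assume "0 < e"
    then show "gap (\<lambda>_. 0) \<le> 0 + ennreal e" using gap_le[OF admissible_zero] by simp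
  qed
qed simp

text \<open>Every positive scale is admissible, and the coordinate bound is proportional to the
  scale.\<close>

lemma gap_eq_0:
  assumes "gap u = 0" "\<And>k. 0 \<le> u k"
  shows "u k = 0"
proof -
  obtain K where K: "K > 0" "\<And>\<rho>. admissible \<rho> u \<Longrightarrow> u k \<le> \<rho> * K"
    using admissible_coord_bound[of k] assms(2) by blast
  have "u k \<le> 0 + e" if "e > 0" for e
  proof -
    have "admissible (e / K) u"
      using assms that K(1) by (intro admissible_of_gap_less) auto
    from K(2)[OF this] show ?thesis using K(1) by simp
  qed
  then have "u k \<le> 0" by (rule field_le_epsilon)
  then show ?thesis using assms(2)[of k] by simp
qed

text \<open>Phrased with \<open>dist_shape\<close>, so that identifying a concrete distance only
  takes a rewriting of its admissibility condition.\<close>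

definition gauge_dist :: "nat \<Rightarrow> nat \<Rightarrow> (nat \<Rightarrow> fuzzy_real) \<Rightarrow> (nat \<Rightarrow> fuzzy_real) \<Rightarrow> ennreal" where
  "gauge_dist m n X Y = dist_shape m n X Y (\<lambda>\<rho>. \<forall>N. F N (dseq M m n \<rho> X Y) \<le> 1)"

abbreviation dgap :: "nat \<Rightarrow> nat \<Rightarrow> (nat \<Rightarrow> fuzzy_real) \<Rightarrow> (nat \<Rightarrow> fuzzy_real) \<Rightarrow> nat \<Rightarrow> real" where
  "dgap m n X Y \<equiv> \<lambda>k. dist (fdiff m n X k) (fdiff m n Y k)"

lemma gauge_dist_eq:
  "gauge_dist m n X Y = ennreal (\<Sum>r<m * n. dist (X r) (Y r)) + gap (dgap m n X Y)"
  by (simp add: gauge_dist_def dist_shape_def gap_def admissible_def dseq_def[abs_def] dist_fuzzy_real_def)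

lemma gauge_dist_commute: "gauge_dist m n X Y = gauge_dist m n Y X"
  by (simp add: gauge_dist_eq dist_commute)

lemma gauge_dist_self: "gauge_dist m n X X = 0"
  by (simp add: gauge_dist_eq gap_zero)

lemma gauge_dist_eq_0: "gauge_dist m n X Y = 0 \<longleftrightarrow> X = Y"
proof
  assume *: "gauge_dist m n X Y = 0"
  then have "(\<Sum>r<m * n. dist (X r) (Y r)) \<le> 0" and g: "gap (dgap m n X Y) = 0"
    by (simp_all add: gauge_dist_eq ennreal_eq_0_iff)
  then have "(\<Sum>r<m * n. dist (X r) (Y r)) = 0" by (simp add: antisym sum_nonneg)
  then have "dist (X r) (Y r) = 0" if "r < m * n" for r
    using that by (subst (asm) sum_nonneg_eq_0_iff) auto
  moreover have "dist (fdiff m n X k) (fdiff m n Y k) = 0" for k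
    by (rule gap_eq_0[OF g]) simp
  ultimately show "X = Y" by (intro fdiff_inject[of m n]) auto
qed (simp add: gauge_dist_self)

lemma gauge_dist_triangle: "gauge_dist m n X Z \<le> gauge_dist m n X Y + gauge_dist m n Y Z"
proof -
  have "(\<Sum>r<m * n. dist (X r) (Z r)) \<le> (\<Sum>r<m * n. dist (X r) (Y r)) + (\<Sum>r<m * n. dist (Y r) (Z r))"
    unfolding sum.distrib[symmetric] by (intro sum_mono dist_triangle)
  then have "ennreal (\<Sum>r<m * n. dist (X r) (Z r))
      \<le> ennreal (\<Sum>r<m * n. dist (X r) (Y r)) + ennreal (\<Sum>r<m * n. dist (Y r) (Z r))"
    by (subst ennreal_plus[symmetric]) (auto intro: sum_nonneg ennreal_leI)
  moreover have "gap (dgap m n X Z) \<le> gap (dgap m n X Y) + gap (dgap m n Y Z)"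
    by (rule gap_triangle) (simp_all add: dist_triangle)
  ultimately have "gauge_dist m n X Z
      \<le> (ennreal (\<Sum>r<m * n. dist (X r) (Y r)) + ennreal (\<Sum>r<m * n. dist (Y r) (Z r)))
        + (gap (dgap m n X Y) + gap (dgap m n Y Z))"
    unfolding gauge_dist_eq by (rule add_mono)
  then show ?thesis by (simp add: gauge_dist_eq ac_simps)
qed

lemma gauge_dist_finite_iff: "gauge_dist m n X Y < \<infinity> \<longleftrightarrow> (\<exists>\<rho>. admissible \<rho> (dgap m n X Y))"
proof
  assume "gauge_dist m n X Y < \<infinity>"
  then show "\<exists>\<rho>. admissible \<rho> (dgap m n X Y)"
    by (intro admissible_of_gap_finite) (auto simp: gauge_dist_eq)
next
  assume "\<exists>\<rho>. admissible \<rho> (dgap m n X Y)"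
  then obtain \<rho> where "gap (dgap m n X Y) \<le> ennreal \<rho>" using gap_le by blast
  then have "gap (dgap m n X Y) < \<infinity>" by (simp add: le_less_trans ennreal_less_top)
  then show "gauge_dist m n X Y < \<infinity>" by (simp add: gauge_dist_eq)
qed

lemma gauge_dist_less:
  assumes "gauge_dist m n X Y < ennreal \<epsilon>"
  shows "(\<Sum>r<m * n. dist (X r) (Y r)) < \<epsilon>" "admissible \<epsilon> (dgap m n X Y)"
proof -
  have "ennreal (\<Sum>r<m * n. dist (X r) (Y r)) \<le> gauge_dist m n X Y" "gap (dgap m n X Y) \<le> gauge_dist m n X Y"
    by (simp_all add: gauge_dist_eq)
  with assms have "ennreal (\<Sum>r<m * n. dist (X r) (Y r)) < ennreal \<epsilon>" "gap (dgap m n X Y) < ennreal \<epsilon>"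
    by (meson le_less_trans)+
  then show "(\<Sum>r<m * n. dist (X r) (Y r)) < \<epsilon>" "admissible \<epsilon> (dgap m n X Y)"
    by (auto intro: admissible_of_gap_less simp: ennreal_less_iff sum_nonneg)
qed

text \<open>The first mn terms are Cauchy by the sum, the differences by the coordinate bound, and
  cancellation makes every term Cauchy. The termwise limit \<open>X\<close> is also the limit for
  the distance: in the Cauchy estimate \<open>j\<close> tends to infinity and admissibility passes
  to the limit.\<close>

lemma gauge_dist_complete:
  assumes "\<And>\<epsilon>. \<epsilon> > 0 \<Longrightarrow> \<exists>N. \<forall>i\<ge>N. \<forall>j\<ge>N. gauge_dist m n (\<sigma> i) (\<sigma> j) < \<epsilon>"
  shows "\<exists>X. (\<lambda>i. gauge_dist m n (\<sigma> i) X) \<longlonglongrightarrow> 0"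
proof -
  have C: "\<exists>N. \<forall>i\<ge>N. \<forall>j\<ge>N. (\<Sum>r<m * n. dist (\<sigma> i r) (\<sigma> j r)) < e \<and> admissible e (dgap m n (\<sigma> i) (\<sigma> j))"
    if "e > 0" for e
    using assms[of "ennreal e"] that gauge_dist_less by (auto simp: ennreal_less_zero_iff) blast
  have "Cauchy (\<lambda>i. \<sigma> i k)" for k
  proof (rule fdiff_cancel[where Q = Cauchy and m = m and n = n])
    show "Cauchy (\<lambda>i. A i - B i)" if "Cauchy A" "Cauchy B" for A B :: "nat \<Rightarrow> fuzzy_real"
      using that by (rule Cauchy_fuzzy_diff)
    show "Cauchy B" if "Cauchy A" "Cauchy (\<lambda>i. A i - B i)" for A B :: "nat \<Rightarrow> fuzzy_real"
      using that by (rule Cauchy_fuzzy_cancel)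
  next
    fix r assume r: "r < m * n"
    show "Cauchy (\<lambda>i. \<sigma> i r)"
    proof (rule metric_CauchyI)
      fix e :: real assume "e > 0"
      then obtain N where N: "\<And>i j. i \<ge> N \<Longrightarrow> j \<ge> N \<Longrightarrow> (\<Sum>r<m * n. dist (\<sigma> i r) (\<sigma> j r)) < e"
        using C by blast
      have "dist (\<sigma> i r) (\<sigma> j r) \<le> (\<Sum>r<m * n. dist (\<sigma> i r) (\<sigma> j r))" for i j
        using r by (intro member_le_sum) auto
      then show "\<exists>N. \<forall>i\<ge>N. \<forall>j\<ge>N. dist (\<sigma> i r) (\<sigma> j r) < e"
        using N by (meson le_less_trans)
    qed
  next
    fix k
    obtain K where K: "K > 0" "\<And>\<rho> u. (\<And>k. 0 \<le> u k) \<Longrightarrow> admissible \<rho> u \<Longrightarrow> u k \<le> \<rho> * K"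
      using admissible_coord_bound[of k] by blast
    show "Cauchy (\<lambda>i. fdiff m n (\<sigma> i) k)"
    proof (rule metric_CauchyI)
      fix e :: real assume e: "e > 0"
      \<comment> \<open>At scale e / 2 / K the coordinate bound is e / 2.\<close>
      then obtain N where N: "\<And>i j. i \<ge> N \<Longrightarrow> j \<ge> N \<Longrightarrow> admissible (e / 2 / K) (dgap m n (\<sigma> i) (\<sigma> j))"
        using C[of "e / 2 / K"] K(1) by auto
      have "dist (fdiff m n (\<sigma> i) k) (fdiff m n (\<sigma> j) k) < e" if "i \<ge> N" "j \<ge> N" for i j
        using K(2)[OF _ N[OF that]] K(1) e by simp
      then show "\<exists>N. \<forall>i\<ge>N. \<forall>j\<ge>N. dist (fdiff m n (\<sigma> i) k) (fdiff m n (\<sigma> j) k) < e" by blast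
    qed
  qed
  then have "\<exists>x. (\<lambda>i. \<sigma> i k) \<longlonglongrightarrow> x" for k
    using Cauchy_convergent convergent_def by blast
  then obtain X where X: "\<And>k. (\<lambda>i. \<sigma> i k) \<longlonglongrightarrow> X k" by metis
  have "(\<lambda>i. gauge_dist m n (\<sigma> i) X) \<longlonglongrightarrow> 0"
  proof (rule order_tendstoI)
    fix \<epsilon> :: ennreal assume "0 < \<epsilon>"
    then obtain e where e: "0 < e" "ennreal e < \<epsilon>" using ennreal_dense_pos by blast
    obtain N where N: "\<And>i j. i \<ge> N \<Longrightarrow> j \<ge> N \<Longrightarrow> (\<Sum>r<m * n. dist (\<sigma> i r) (\<sigma> j r)) < e / 2"
        "\<And>i j. i \<ge> N \<Longrightarrow> j \<ge> N \<Longrightarrow> admissible (e / 2) (dgap m n (\<sigma> i) (\<sigma> j))"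
      using C[OF half_gt_zero[OF e(1)]] by blast
    have "gauge_dist m n (\<sigma> i) X < \<epsilon>" if i: "i \<ge> N" for i
    proof -
      have "(\<Sum>r<m * n. dist (\<sigma> i r) (X r)) \<le> e / 2"
      proof (rule LIMSEQ_le_const2)
        show "(\<lambda>j. \<Sum>r<m * n. dist (\<sigma> i r) (\<sigma> j r)) \<longlonglongrightarrow> (\<Sum>r<m * n. dist (\<sigma> i r) (X r))"
          by (intro tendsto_sum tendsto_dist tendsto_const X)
        show "\<exists>N. \<forall>j\<ge>N. (\<Sum>r<m * n. dist (\<sigma> i r) (\<sigma> j r)) \<le> e / 2"
          using N(1)[OF i] by (meson less_imp_le)
      qed
      moreover have "admissible (e / 2) (dgap m n (\<sigma> i) X)"
      proof (rule admissible_limit)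
        \<comment> \<open>Shifting by \<open>N\<close> makes every member of the sequence
          admissible.\<close>
        show "(\<lambda>j. dgap m n (\<sigma> i) (\<sigma> (j + N)) k) \<longlonglongrightarrow> dgap m n (\<sigma> i) X k" for k
          by (intro tendsto_dist tendsto_const LIMSEQ_ignore_initial_segment tendsto_fdiff X)
      qed (use N(2)[OF i] in auto)
      ultimately have "gauge_dist m n (\<sigma> i) X \<le> ennreal (e / 2) + ennreal (e / 2)"
        unfolding gauge_dist_eq by (intro add_mono ennreal_leI gap_le)
      also have "\<dots> = ennreal e" using e(1) by (simp flip: ennreal_plus)
      finally show ?thesis using e(2) by simp
    qed
    then show "\<forall>\<^sub>F i in sequentially. gauge_dist m n (\<sigma> i) X < \<epsilon>"
      by (auto simp: eventually_sequentially)
  qed simp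
  then show ?thesis by blast
qed

text \<open>The limit found among all sequences is at finite distance from some term, so it belongs
  to any \<open>S\<close> that is closed under finite distance.\<close>

lemma complete_extended_gauge_dist:
  assumes closed: "\<And>X Y. X \<in> S \<Longrightarrow> gauge_dist m n X Y < \<infinity> \<Longrightarrow> Y \<in> S"
  shows "complete_extended_metric_on S (gauge_dist m n)"
  unfolding complete_extended_metric_on_def
proof (intro conjI ballI allI impI)
  fix \<sigma> :: "nat \<Rightarrow> nat \<Rightarrow> fuzzy_real"
  assume \<sigma>: "range \<sigma> \<subseteq> S \<and> (\<forall>\<epsilon>>0. \<exists>N. \<forall>i\<ge>N. \<forall>j\<ge>N. gauge_dist m n (\<sigma> i) (\<sigma> j) < \<epsilon>)"
  then obtain X where X: "(\<lambda>i. gauge_dist m n (\<sigma> i) X) \<longlonglongrightarrow> 0"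
    using gauge_dist_complete[of m n \<sigma>] by blast
  have "\<forall>\<^sub>F i in sequentially. gauge_dist m n (\<sigma> i) X < \<infinity>"
    using X by (rule order_tendstoD) simp
  then obtain i where "gauge_dist m n (\<sigma> i) X < \<infinity>"
    by (auto simp: eventually_sequentially)
  then have "X \<in> S" using closed \<sigma> by blast
  then show "\<exists>X\<in>S. (\<lambda>i. gauge_dist m n (\<sigma> i) X) \<longlonglongrightarrow> 0" using X by blast
qed (rule gauge_dist_eq_0 gauge_dist_commute gauge_dist_triangle)+

definition gauge_space :: "nat \<Rightarrow> nat \<Rightarrow> (nat \<Rightarrow> fuzzy_real) set" where
  "gauge_space m n = {X. \<exists>\<rho>>0. bdd_above (range (\<lambda>N. F N (tseq M m n \<rho> X)))}"

lemma gauge_space_iff: "X \<in> gauge_space m n \<longleftrightarrow> (\<exists>\<rho>. admissible \<rho> (\<lambda>k. dist (fdiff m n X k) (crisp 0)))"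
proof
  assume "X \<in> gauge_space m n"
  then obtain \<rho> B where "0 < \<rho>" "\<And>N. F N (\<lambda>k. M (dist (fdiff m n X k) (crisp 0) / \<rho>)) \<le> B"
    by (auto simp: gauge_space_def bdd_above_def tseq_def[abs_def] dist_fuzzy_real_def)
  then show "\<exists>\<rho>. admissible \<rho> (\<lambda>k. dist (fdiff m n X k) (crisp 0))"
    by (intro admissible_of_bounded) auto
next
  assume "\<exists>\<rho>. admissible \<rho> (\<lambda>k. dist (fdiff m n X k) (crisp 0))"
  then show "X \<in> gauge_space m n"
    by (auto simp: gauge_space_def admissible_def tseq_def[abs_def] dist_fuzzy_real_def intro!: bdd_aboveI)
qed

text \<open>Both closure under finite distance and finiteness between members are triangle
  inequalities for admissible scales, with the constant sequence \<open>crisp 0\<close> as third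
  point on the level of the differences.\<close>

lemma complete_gauge_space: "complete_metric_on (gauge_space m n) (gauge_dist m n)"
proof (rule complete_metric_onI[OF complete_extended_gauge_dist gauge_dist_commute])
  fix X Y assume "X \<in> gauge_space m n" "gauge_dist m n X Y < \<infinity>"
  then obtain \<rho> \<sigma> where "admissible \<rho> (\<lambda>k. dist (fdiff m n X k) (crisp 0))" "admissible \<sigma> (dgap m n X Y)"
    unfolding gauge_space_iff gauge_dist_finite_iff by blast
  from admissible_add[OF this(2) _ this(1), of "\<lambda>k. dist (fdiff m n Y k) (crisp 0)"]
  have "admissible (\<sigma> + \<rho>) (\<lambda>k. dist (fdiff m n Y k) (crisp 0))"
    by (simp add: dist_triangle3)
  then show "Y \<in> gauge_space m n" unfolding gauge_space_iff ..
next
  fix X Y assume "X \<in> gauge_space m n" "Y \<in> gauge_space m n"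
  then obtain \<rho> \<sigma> where "admissible \<rho> (\<lambda>k. dist (fdiff m n X k) (crisp 0))"
      "admissible \<sigma> (\<lambda>k. dist (fdiff m n Y k) (crisp 0))"
    unfolding gauge_space_iff by blast
  from admissible_add[OF this(1) _ this(2), of "dgap m n X Y"]
  have "admissible (\<rho> + \<sigma>) (dgap m n X Y)" by (simp add: dist_triangle2)
  then show "gauge_dist m n X Y < \<infinity>" unfolding gauge_dist_finite_iff ..
qed

end

section \<open>The sequence spaces\<close>

lemma summable_iff_bdd_above_partial_sums:
  fixes a :: "nat \<Rightarrow> real"
  assumes "\<And>i. 0 \<le> a i"
  shows "summable a \<longleftrightarrow> bdd_above (range (\<lambda>N. \<Sum>i<N. a i))"
proof
  assume "summable a"
  then show "bdd_above (range (\<lambda>N. \<Sum>i<N. a i))"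
    using assms by (intro bdd_aboveI2[of _ _ "suminf a"] sum_le_suminf) auto
next
  assume "bdd_above (range (\<lambda>N. \<Sum>i<N. a i))"
  then show "summable a"
    using assms by (auto simp: bdd_above_def intro: summableI_nonneg_bounded)
qed

lemma powr_le_one_imp_le_one:
  fixes x p :: real
  assumes "x powr p \<le> 1" "0 < p"
  shows "x \<le> 1"
  using assms gr_one_powr[of x p] by (meson not_le)

text \<open>Taking the p-th root does not affect comparison with 1, and a nonnegative series is at
  most 1 exactly when its partial sums are. This yields the countable form that
  \<open>gauge_family\<close> uses.\<close>

lemma root_sum_le_1_iff:
  assumes "\<And>i. 0 \<le> a i" "1 \<le> p"
  shows "root_sum_le_1 p a \<longleftrightarrow> (\<forall>N. (\<Sum>i<N. a i) \<le> 1)"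
proof
  assume "root_sum_le_1 p a"
  then have sm: "summable a" and le: "(\<Sum>i. a i) powr (1 / p) \<le> 1"
    by (simp_all add: root_sum_le_1_def)
  from le have "(\<Sum>i. a i) \<le> 1"
    by (rule powr_le_one_imp_le_one) (use assms(2) in simp)
  then show "\<forall>N. (\<Sum>i<N. a i) \<le> 1"
    using assms(1) sum_le_suminf[OF sm] by (meson finite_lessThan order_trans)
next
  assume N: "\<forall>N. (\<Sum>i<N. a i) \<le> 1"
  then have sm: "summable a" using assms(1) by (intro summableI_nonneg_bounded[of a 1]) auto
  have "(\<Sum>i. a i) \<le> 1" using sm N by (intro suminf_le_const) auto
  then have "(\<Sum>i. a i) powr (1 / p) \<le> 1 powr (1 / p)"
    using assms sm by (intro powr_mono2 suminf_nonneg) auto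
  then show "root_sum_le_1 p a" using sm by (simp add: root_sum_le_1_def)
qed

lemma sup_le_1_iff: "sup_le_1 a \<longleftrightarrow> (\<forall>i. a i \<le> 1)"
proof
  assume "sup_le_1 a"
  then show "\<forall>i. a i \<le> 1"
    unfolding sup_le_1_def by (meson cSUP_upper UNIV_I order_trans)
next
  assume "\<forall>i. a i \<le> 1"
  then show "sup_le_1 a"
    unfolding sup_le_1_def by (auto intro!: bdd_aboveI cSUP_least)
qed

text \<open>If b k were positive, the terms from \<open>k\<close> on would dominate b k times the
  harmonic series.\<close>

lemma summable_harmonic_weight_imp_zero:
  fixes b :: "nat \<Rightarrow> real"
  assumes sm: "summable (\<lambda>i. (1 / real (Suc i)) * b i)" and b: "mono b" "\<And>i. 0 \<le> b i"
  shows "b k = 0"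
proof (rule ccontr)
  assume "b k \<noteq> 0"
  then have pos: "0 < b k" using b(2)[of k] by simp
  have "summable (\<lambda>i. (1 / real (Suc i)) * b k)"
  proof (rule summable_comparison_test')
    show "norm ((1 / real (Suc i)) * b k) \<le> (1 / real (Suc i)) * b i" if "k \<le> i" for i
      using pos monoD[OF b(1) that] by (simp add: divide_right_mono)
  qed (rule sm)
  then have "summable (\<lambda>i. (1 / real (Suc i)) * b k * (1 / b k))" by (rule summable_mult2)
  then have "summable (\<lambda>i. inverse (real (Suc i)))" using pos by (simp add: inverse_eq_divide)
  then have "summable (\<lambda>i. inverse (real i))" by (subst (asm) summable_Suc_iff)
  then show False using not_summable_harmonic[where 'a = real] by simp
qed

definition cesaro_sum :: "real \<Rightarrow> nat \<Rightarrow> (nat \<Rightarrow> real) \<Rightarrow> real" where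
  "cesaro_sum p N u = (\<Sum>i<N. ((1 / real (Suc i)) * (\<Sum>k\<le>i. u k)) powr p)"

definition cesaro_mean :: "nat \<Rightarrow> (nat \<Rightarrow> real) \<Rightarrow> real" where
  "cesaro_mean N u = (1 / real (Suc N)) * (\<Sum>k\<le>N. u k)"

definition power_sum :: "real \<Rightarrow> nat \<Rightarrow> (nat \<Rightarrow> real) \<Rightarrow> real" where
  "power_sum p N u = (\<Sum>k<N. u k powr p)"

definition harmonic_power_sum :: "real \<Rightarrow> nat \<Rightarrow> (nat \<Rightarrow> real) \<Rightarrow> real" where
  "harmonic_power_sum p N u = (\<Sum>i<N. (1 / real (Suc i)) * (\<Sum>k\<le>i. u k powr p))"

text \<open>The inner sums of p-th powers increase with \<open>i\<close>, so the harmonic weights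
  force them to vanish.\<close>

lemma harmonic_power_sum_bounded_imp_zero:
  assumes u: "\<And>k. 0 \<le> u k" and B: "\<And>N. harmonic_power_sum p N u \<le> B"
  shows "u k = 0"
proof -
  have "summable (\<lambda>i. (1 / real (Suc i)) * (\<Sum>k\<le>i. u k powr p))"
    using B by (intro summableI_nonneg_bounded) (auto simp: harmonic_power_sum_def intro!: sum_nonneg divide_nonneg_nonneg)
  then have "(\<Sum>j\<le>k. u j powr p) = 0"
    by (rule summable_harmonic_weight_imp_zero) (auto intro!: monoI sum_mono2 sum_nonneg)
  then show ?thesis by (simp add: sum_nonneg_eq_0_iff)
qed

lemma cesaro_mean_ge:
  assumes "\<And>k. 0 \<le> u k"
  shows "u k / real (Suc k) \<le> cesaro_mean k u"
  using member_le_sum[of k "{..k}" u] assms by (simp add: cesaro_mean_def divide_right_mono)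

section \<open>The concrete families and spaces for a fixed Orlicz function\<close>

context
  fixes M :: "real \<Rightarrow> real" and p :: real
  assumes M: "orlicz M" and p: "1 \<le> p"
begin

text \<open>A single summand of the truncated series bounds the k-th mean by 1, and u k is at most k
  + 1 times that mean.\<close>

lemma gauge_family_cesaro_sum: "gauge_family M (cesaro_sum p)"
proof
  show "cone_convex (cesaro_sum p N)" for N
    unfolding cesaro_sum_def[abs_def] by (intro cone_convex_intros p) simp
  have "u k \<le> real (Suc k)" if u: "\<And>k. 0 \<le> u k" and le: "\<And>N. cesaro_sum p N u \<le> 1" for u k
  proof -
    have "cesaro_mean k u powr p \<le> cesaro_sum p (Suc k) u"
      unfolding cesaro_sum_def cesaro_mean_def by (rule member_le_sum) auto
    then have "cesaro_mean k u \<le> 1"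
      using le[of "Suc k"] p powr_le_one_imp_le_one[of "cesaro_mean k u" p] by simp
    then have "u k / real (Suc k) \<le> 1" by (rule order_trans[OF cesaro_mean_ge[OF u]])
    then show ?thesis by (simp add: divide_le_eq)
  qed
  then show "\<exists>C. \<forall>u. (\<forall>k. 0 \<le> u k) \<longrightarrow> (\<forall>N. cesaro_sum p N u \<le> 1) \<longrightarrow> u k \<le> C" for k by blast
qed (rule M)

lemma gauge_family_cesaro_mean: "gauge_family M cesaro_mean"
proof
  show "cone_convex (cesaro_mean N)" for N
    unfolding cesaro_mean_def[abs_def] by (intro cone_convex_intros) simp
  have "u k \<le> real (Suc k)" if u: "\<And>k. 0 \<le> u k" and le: "\<And>N. cesaro_mean N u \<le> 1" for u k
  proof -
    have "u k / real (Suc k) \<le> 1" by (rule order_trans[OF cesaro_mean_ge[OF u] le])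
    then show ?thesis by (simp add: divide_le_eq)
  qed
  then show "\<exists>C. \<forall>u. (\<forall>k. 0 \<le> u k) \<longrightarrow> (\<forall>N. cesaro_mean N u \<le> 1) \<longrightarrow> u k \<le> C" for k by blast
qed (rule M)

lemma gauge_family_power_sum: "gauge_family M (power_sum p)"
proof
  show "cone_convex (power_sum p N)" for N
    unfolding power_sum_def[abs_def] by (intro cone_convex_intros p)
  have "u k \<le> 1" if le: "\<And>N. power_sum p N u \<le> 1" for u k
  proof -
    have "u k powr p \<le> power_sum p (Suc k) u"
      unfolding power_sum_def by (rule member_le_sum) auto
    then show ?thesis
      using le[of "Suc k"] p powr_le_one_imp_le_one[of "u k" p] by simp
  qed
  then show "\<exists>C. \<forall>u. (\<forall>k. 0 \<le> u k) \<longrightarrow> (\<forall>N. power_sum p N u \<le> 1) \<longrightarrow> u k \<le> C" for k by blast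
qed (rule M)

text \<open>The coordinate bound is 0: only the zero sequence satisfies all the
  inequalities.\<close>

lemma gauge_family_harmonic_power_sum: "gauge_family M (harmonic_power_sum p)"
proof
  show "cone_convex (harmonic_power_sum p N)" for N
    unfolding harmonic_power_sum_def[abs_def] by (intro cone_convex_intros p) simp
  have "u k \<le> 0" if "\<And>k. 0 \<le> u k" "\<And>N. harmonic_power_sum p N u \<le> 1" for u k
    using harmonic_power_sum_bounded_imp_zero[OF that, of k] by simp
  then show "\<exists>C. \<forall>u. (\<forall>k. 0 \<le> u k) \<longrightarrow> (\<forall>N. harmonic_power_sum p N u \<le> 1) \<longrightarrow> u k \<le> C" for k by blast
qed (rule M)

lemma orlicz_div_eq_0: "0 < \<rho> \<Longrightarrow> 0 \<le> x \<Longrightarrow> M (x / \<rho>) = 0 \<longleftrightarrow> x = 0"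
  using orlicz_pos[OF M, of "x / \<rho>"] orlicz_zero[OF M] by (cases "x = 0") auto

lemma tseq_nonneg: "0 < \<rho> \<Longrightarrow> 0 \<le> tseq M m n \<rho> X k"
  unfolding tseq_def dist_fuzzy_real_def[symmetric] by (intro orlicz_nonneg[OF M]) auto

lemma tseq_eq_0_iff: "0 < \<rho> \<Longrightarrow> tseq M m n \<rho> X k = 0 \<longleftrightarrow> fdiff m n X k = crisp 0"
  unfolding tseq_def dist_fuzzy_real_def[symmetric] by (simp add: orlicz_div_eq_0)

text \<open>The space has the power outside the inner sum, \<open>f4\<close> has it inside, so the
  space is not literally the gauge space of \<open>harmonic_power_sum\<close>. Divergence of the
  harmonic series gives both the same description.\<close>

lemma O_p_eq: "O_p p M m n = {X. \<forall>k. fdiff m n X k = crisp 0}"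
proof (intro set_eqI iffI)
  fix X assume "X \<in> O_p p M m n"
  then obtain \<rho> where \<rho>: "0 < \<rho>"
    and sm: "summable (\<lambda>i. (1 / real (Suc i)) * (\<Sum>k\<le>i. tseq M m n \<rho> X k) powr p)"
    by (auto simp: O_p_def)
  have *: "(\<Sum>j\<le>k. tseq M m n \<rho> X j) powr p = 0" for k
    using sm
  proof (rule summable_harmonic_weight_imp_zero)
    show "mono (\<lambda>i. (\<Sum>k\<le>i. tseq M m n \<rho> X k) powr p)"
      using p tseq_nonneg[OF \<rho>] by (intro monoI powr_mono2 sum_mono2 sum_nonneg) auto
  qed simp
  have "tseq M m n \<rho> X k = 0" for k
    using *[of k] tseq_nonneg[OF \<rho>] sum_nonneg_eq_0_iff[of "{..k}" "tseq M m n \<rho> X"] by simp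
  then show "X \<in> {X. \<forall>k. fdiff m n X k = crisp 0}" using tseq_eq_0_iff[OF \<rho>] by simp
next
  fix X assume "X \<in> {X. \<forall>k. fdiff m n X k = crisp 0}"
  then have "tseq M m n 1 X k = 0" for k using tseq_eq_0_iff[of 1] by simp
  then show "X \<in> O_p p M m n" by (auto simp: O_p_def intro!: exI[of _ 1])
qed

lemma gauge_space_harmonic_power_sum:
  "gauge_family.gauge_space M (harmonic_power_sum p) m n = {X. \<forall>k. fdiff m n X k = crisp 0}"
proof -
  interpret gauge_family M "harmonic_power_sum p" by (rule gauge_family_harmonic_power_sum)
  show ?thesis
  proof (intro set_eqI iffI)
    fix X assume "X \<in> gauge_space m n"
    then obtain \<rho> B where \<rho>: "0 < \<rho>" and "\<And>N. harmonic_power_sum p N (tseq M m n \<rho> X) \<le> B"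
      by (auto simp: gauge_space_def bdd_above_def)
    then have "tseq M m n \<rho> X k = 0" for k
      using tseq_nonneg[OF \<rho>] by (intro harmonic_power_sum_bounded_imp_zero)
    then show "X \<in> {X. \<forall>k. fdiff m n X k = crisp 0}" using tseq_eq_0_iff[OF \<rho>] by simp
  next
    fix X assume "X \<in> {X. \<forall>k. fdiff m n X k = crisp 0}"
    then have "tseq M m n 1 X k = 0" for k using tseq_eq_0_iff[of 1] by simp
    then show "X \<in> gauge_space m n"
      by (auto simp: gauge_space_def harmonic_power_sum_def intro!: exI[of _ 1])
  qed
qed

lemma gauge_dist_harmonic_power_sum:
  "gauge_family.gauge_dist M (harmonic_power_sum p) m n = f1 p M m n"
  "gauge_family.gauge_dist M (harmonic_power_sum p) m n = f4 p M m n"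
proof -
  interpret gauge_family M "harmonic_power_sum p" by (rule gauge_family_harmonic_power_sum)
  have "root_sum_le_1 p (\<lambda>i. (1 / real (Suc i)) * (\<Sum>k\<le>i. dseq M m n \<rho> X Y k powr p))
      \<longleftrightarrow> (\<forall>N. harmonic_power_sum p N (dseq M m n \<rho> X Y) \<le> 1)" for \<rho> X Y
    unfolding harmonic_power_sum_def by (rule root_sum_le_1_iff) (use p in \<open>auto intro!: sum_nonneg divide_nonneg_nonneg\<close>)
  then show "gauge_dist m n = f1 p M m n" "gauge_dist m n = f4 p M m n"
    by (simp_all add: fun_eq_iff gauge_dist_def f1_def f4_def)
qed

text \<open>A finite \<open>f1\<close> distance forces equal difference sequences, and membership in
  \<open>C_p\<close> depends on the differences alone, so the space is closed under finite
  distance.\<close>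

lemma complete_extended_C_p: "complete_extended_metric_on (C_p p M m n) (f1 p M m n)"
proof -
  interpret gauge_family M "harmonic_power_sum p" by (rule gauge_family_harmonic_power_sum)
  have "Y \<in> C_p p M m n" if X: "X \<in> C_p p M m n" and fin: "gauge_dist m n X Y < \<infinity>" for X Y
  proof -
    obtain \<rho> where \<rho>: "admissible \<rho> (dgap m n X Y)"
      using fin unfolding gauge_dist_finite_iff ..
    have "M (dgap m n X Y k / \<rho>) = 0" for k
      by (rule harmonic_power_sum_bounded_imp_zero[where u = "\<lambda>k. M (dgap m n X Y k / \<rho>)" and B = 1 and p = p])
        (use \<rho> in \<open>auto simp: admissible_def intro: orlicz_nonneg[OF M]\<close>)
    then have "fdiff m n X = fdiff m n Y"
      using \<rho> by (auto simp: admissible_def orlicz_div_eq_0)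
    then show ?thesis using X by (simp add: C_p_def tseq_def)
  qed
  then show ?thesis
    unfolding gauge_dist_harmonic_power_sum(1)[symmetric] by (rule complete_extended_gauge_dist)
qed

lemma complete_C_p_avg: "complete_metric_on (C_p p M m n) (f1_avg p M m n)"
proof -
  interpret gauge_family M "cesaro_sum p" by (rule gauge_family_cesaro_sum)
  have "gauge_dist m n = f1_avg p M m n"
    by (simp add: fun_eq_iff gauge_dist_def f1_avg_def cesaro_sum_def root_sum_le_1_iff p)
  moreover have "gauge_space m n = C_p p M m n"
    by (simp add: gauge_space_def C_p_def cesaro_sum_def summable_iff_bdd_above_partial_sums)
  ultimately show ?thesis using complete_gauge_space[of m n] by simp
qed

lemma complete_C_inf: "complete_metric_on (C_inf M m n) (f2 M m n)"
proof -
  interpret gauge_family M cesaro_mean by (rule gauge_family_cesaro_mean)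
  have "gauge_dist m n = f2 M m n"
    by (simp add: fun_eq_iff gauge_dist_def f2_def cesaro_mean_def sup_le_1_iff)
  moreover have "gauge_space m n = C_inf M m n"
    by (simp add: gauge_space_def C_inf_def cesaro_mean_def)
  ultimately show ?thesis using complete_gauge_space[of m n] by simp
qed

lemma complete_l_p: "complete_metric_on (l_p p M m n) (f3 p M m n)"
proof -
  interpret gauge_family M "power_sum p" by (rule gauge_family_power_sum)
  have "gauge_dist m n = f3 p M m n"
    by (simp add: fun_eq_iff gauge_dist_def f3_def power_sum_def root_sum_le_1_iff p)
  moreover have "gauge_space m n = l_p p M m n"
    by (simp add: gauge_space_def l_p_def power_sum_def summable_iff_bdd_above_partial_sums)
  ultimately show ?thesis using complete_gauge_space[of m n] by simp
qed

text \<open>All members have the same, zero, differences, so the gauge part of \<open>f4\<close>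
  vanishes on this space and the distance is finite.\<close>

lemma complete_O_p: "complete_metric_on (O_p p M m n) (f4 p M m n)"
proof -
  interpret gauge_family M "harmonic_power_sum p" by (rule gauge_family_harmonic_power_sum)
  show ?thesis
    using complete_gauge_space[of m n]
    by (simp add: gauge_space_harmonic_power_sum gauge_dist_harmonic_power_sum(2) O_p_eq)
qed

end

theorem proposition3p2:
  fixes M :: "real \<Rightarrow> real" and m n :: nat and p :: real
  assumes "orlicz M" and "1 \<le> p"
  shows "(complete_extended_metric_on (C_p p M m n) (f1 p M m n)
          \<and> complete_metric_on (C_p p M m n) (f1_avg p M m n))
       \<and> complete_metric_on (C_inf M m n) (f2 M m n)
       \<and> complete_metric_on (l_p p M m n) (f3 p M m n)
       \<and> complete_metric_on (O_p p M m n) (f4 p M m n)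
       \<and> complete_metric_on (O_inf M m n) (f5 M m n)"
proof -
  \<comment> \<open>The two spaces, and likewise the two distances, are given by the same
    formulas.\<close>
  have "O_inf M m n = C_inf M m n" "f5 M m n = f2 M m n"
    by (simp_all add: O_inf_def C_inf_def f5_def f2_def fun_eq_iff)
  then show ?thesis
    using complete_extended_C_p complete_C_p_avg complete_C_inf complete_l_p complete_O_p assms by simp
qed

end
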